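(* Let $M\ge 2$ and consider a $3$-user MIMO interference channel in which every transmitter and every receiver has $M$ antennas (no symbol extension). Then, with probability one over the channel matrices, the maximum SpAC per transmitter that is achievable without an error floor in the BER as $\sigma^2\to0$, and without any information transfer (co-operation) between the receivers, is $\frac{M-1}{M}$. That is, $\big(\frac{M-1}{M},\frac{M-1}{M},\frac{M-1}{M}\big)$ is achievable, and no transmitter can have SpAC larger than $\frac{M-1}{M}$ in an achievable tuple.
   Context: System: receiver $i\in\{1,2,3\}$ observes $\mathbf{y}_i=\sum_{j=1}^3\mathbf{H}_{i,j}\mathbf{Q}_j\mathbf{x}_j+\mathbf{z}_i$, where $\mathbf{z}_i$ is zero-mean white Gaussian noise with covariance $\sigma^2\mathbf{I}_M$, $\mathbf{H}_{i,j}$ is an $M\times M$ complex matrix, and all entries of all channel matrices are independent, identically and continuously distributed (so each $\mathbf{H}_{i,j}$ is nonsingular almost surely). $\mathbf{Q}_j$ is the $M\times n_j$ precoder of transmitter $j$, of full column rank, and may depend on all channel matrices. $\mathbf{x}_j$ is an $n_j\times1$ symbol vector ($n_j\geq 1$) from a finite set $\mathcal{X}_j$ (finite alphabet signaling). SpAC (Symbols per transmit-Antenna per Channel use) of transmitter $j$: the number of symbol streams per available transmit dimension, $n_j/M$. Detection: receiver $i$ uses the minimum distance (MD) detector, which decodes only the desired signal, $\hat{\mathbf{x}}_i=\arg\min_{\mathbf{x}\in\mathcal{X}_i}(\mathbf{y}_i-\mathbf{H}_{i,i}\mathbf{Q}_i\mathbf{x})^{\mathrm H}\mathbf{R}_i^{-1}(\mathbf{y}_i-\mathbf{H}_{i,i}\mathbf{Q}_i\mathbf{x})$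 with $\mathbf{R}_i=\sigma^2\mathbf{I}_M+\sum_{j\ne i}\mathbf{H}_{i,j}\mathbf{Q}_j\mathbf{Q}_j^{\mathrm H}\mathbf{H}_{i,j}^{\mathrm H}$. In all error-rate statements the interference plus noise at receiver $i$ is modeled as zero-mean colored Gaussian with covariance $\mathbf{R}_i$. Fractional Interference Alignment (FIA) constraint: with $\mathcal{S}_i=\operatorname{span}(\mathbf{H}_{i,i}\mathbf{Q}_i)$ (column space) and $\mathcal{I}_i$ the subspace spanned by the columns of all $\mathbf{H}_{i,j}\mathbf{Q}_j$, $j\neq i$, one requires $\mathcal{S}_i\nsubseteq\mathcal{I}_i$ for all $i$, in the form $\dim\mathcal{I}_i<M$ and $\dim(\mathcal{S}_i+\mathcal{I}_i)=M$. A tuple $(n_1/M,n_2/M,n_3/M)$ is achievable without an error floor if there are precoders $\mathbf{Q}_j$ of size $M\times n_j$ satisfying the FIA constraint at every receiver and for which the BER of the MD detector at every receiver tends to $0$ as $\sigma^2\to0$. *)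

theory Defs
  imports "HOL-Probability.Probability"
begin

text \<open>
  The type \<^typ>\<open>3\<close> indexes the users and \<open>'m\<close> the antennas of every terminal, so
  \<open>M = CARD('m)\<close>. Since the numbers of streams vary, an \<open>M \<times> n\<close> precoder is given by
  its columns \<open>Q l\<close> with \<open>l < n\<close>, and a symbol vector of length \<open>n\<close> by an element of
  \<^term>\<open>extensional {..<n}\<close>.
\<close>

type_synonym 'm channel = "3 \<Rightarrow> 3 \<Rightarrow> complex ^ 'm ^ 'm"
type_synonym 'm columns = "nat \<Rightarrow> complex ^ 'm"
type_synonym symbols = "nat \<Rightarrow> complex"

definition columns_mult :: "nat \<Rightarrow> 'm::finite columns \<Rightarrow> symbols \<Rightarrow> complex ^ 'm" where
  "columns_mult n A x = (\<Sum>l<n. x l *s A l)"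

definition columns_gram :: "nat \<Rightarrow> 'm::finite columns \<Rightarrow> complex ^ 'm ^ 'm" where \<comment> \<open>\<open>A A\<^sup>H\<close>\<close>
  "columns_gram n A = (\<chi> a b. \<Sum>l<n. A l $ a * cnj (A l $ b))"

definition column_space :: "nat \<Rightarrow> 'm::finite columns \<Rightarrow> (complex ^ 'm) set" where
  "column_space n A = vec.span (A ` {..<n})"

definition full_column_rank :: "nat \<Rightarrow> 'm::finite columns \<Rightarrow> bool" where
  "full_column_rank n A \<longleftrightarrow> vec.dim (column_space n A) = n"

definition received :: "'m::finite channel \<Rightarrow> (3 \<Rightarrow> 'm columns) \<Rightarrow> 3 \<Rightarrow> 3 \<Rightarrow> 'm columns" where
  \<comment> \<open>the columns of \<open>H\<^sub>i\<^sub>j Q\<^sub>j\<close>\<close>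
  "received H Q i j = (\<lambda>l. H i j *v Q j l)"

definition signal_space ::
  "'m::finite channel \<Rightarrow> (3 \<Rightarrow> nat) \<Rightarrow> (3 \<Rightarrow> 'm columns) \<Rightarrow> 3 \<Rightarrow> (complex ^ 'm) set" where
  "signal_space H n Q i = column_space (n i) (received H Q i i)"

definition interference_space ::
  "'m::finite channel \<Rightarrow> (3 \<Rightarrow> nat) \<Rightarrow> (3 \<Rightarrow> 'm columns) \<Rightarrow> 3 \<Rightarrow> (complex ^ 'm) set" where
  "interference_space H n Q i = vec.span (\<Union>j\<in>UNIV - {i}. received H Q i j ` {..<n j})"

definition FIA ::
  "'m::finite channel \<Rightarrow> (3 \<Rightarrow> nat) \<Rightarrow> (3 \<Rightarrow> 'm columns) \<Rightarrow> 3 \<Rightarrow> bool" where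
  "FIA H n Q i \<longleftrightarrow>
     vec.dim (interference_space H n Q i) < CARD('m) \<and>
     vec.dim {u + v | u v. u \<in> signal_space H n Q i \<and> v \<in> interference_space H n Q i} = CARD('m)"

definition interference_noise_cov ::
  "'m::finite channel \<Rightarrow> (3 \<Rightarrow> nat) \<Rightarrow> (3 \<Rightarrow> 'm columns) \<Rightarrow> real \<Rightarrow> 3 \<Rightarrow> complex ^ 'm ^ 'm" where
  \<comment> \<open>the real argument is the noise variance \<open>\<sigma>\<^sup>2\<close>, not \<open>\<sigma>\<close>\<close>
  "interference_noise_cov H n Q s i =
     mat (complex_of_real s) + (\<Sum>j\<in>UNIV - {i}. columns_gram (n j) (received H Q i j))"

definition hermitian_form :: "complex ^ 'm ^ 'm \<Rightarrow> complex ^ 'm::finite \<Rightarrow> real" where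
  \<comment> \<open>\<open>w\<^sup>H A w\<close>, which is real for Hermitian \<open>A\<close>\<close>
  "hermitian_form A w = Re (\<Sum>a\<in>UNIV. cnj (w $ a) * (A *v w) $ a)"

definition complex_gaussian :: "complex ^ 'm ^ 'm \<Rightarrow> (complex ^ 'm::finite) measure" where
  \<comment> \<open>zero-mean circularly symmetric complex Gaussian law with covariance \<open>E[w w\<^sup>H] = R\<close>,
      for Hermitian positive definite \<open>R\<close>\<close>
  "complex_gaussian R =
     density lborel (\<lambda>w. ennreal (exp (- hermitian_form (matrix_inv R) w) /
                                  (pi ^ CARD('m) * Re (det R))))"

definition MD_detector ::
  "'m::finite channel \<Rightarrow> (3 \<Rightarrow> nat) \<Rightarrow> (3 \<Rightarrow> 'm columns) \<Rightarrow> real \<Rightarrow> 3 \<Rightarrow> symbols set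
    \<Rightarrow> complex ^ 'm \<Rightarrow> symbols" where
  "MD_detector H n Q s i X y =
     arg_min_on (\<lambda>x. hermitian_form (matrix_inv (interference_noise_cov H n Q s i))
                       (y - columns_mult (n i) (received H Q i i) x)) X"

text \<open>
  The bit error rate at receiver \<open>i\<close> for equiprobable symbol vectors from \<open>X\<close>, each of which
  carries the \<open>b\<close> bits \<open>lab x\<close>: the error probability averaged over symbol vectors and bit
  positions. The interference plus noise \<open>w\<close> is Gaussian. The error events are Borel, because
  \<^const>\<open>arg_min_on\<close> depends only on the set of minimizers.
\<close>

definition BER ::
  "'m::finite channel \<Rightarrow> (3 \<Rightarrow> nat) \<Rightarrow> (3 \<Rightarrow> 'm columns) \<Rightarrow> real \<Rightarrow> 3 \<Rightarrow> symbols set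
    \<Rightarrow> nat \<Rightarrow> (symbols \<Rightarrow> bool list) \<Rightarrow> real" where
  "BER H n Q s i X b lab =
     (\<Sum>x\<in>X. \<Sum>k<b.
        measure (complex_gaussian (interference_noise_cov H n Q s i))
          {w. lab (MD_detector H n Q s i X (columns_mult (n i) (received H Q i i) x + w)) ! k
              \<noteq> lab x ! k})
     / (real (card X) * real b)"

text \<open>
  A signaling scheme fixes, for every user \<open>j\<close> and every number \<open>n\<close> of streams, the finite
  alphabet \<open>X j n\<close> of symbol vectors of length \<open>n\<close> and an injective labelling of it by
  \<open>b j n\<close> bits.
\<close>

definition finite_signaling ::
  "(3 \<Rightarrow> nat \<Rightarrow> symbols set) \<Rightarrow> (3 \<Rightarrow> nat \<Rightarrow> nat) \<Rightarrow> (3 \<Rightarrow> nat \<Rightarrow> symbols \<Rightarrow> bool list) \<Rightarrow> bool" where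
  "finite_signaling X b lab \<longleftrightarrow>
     (\<forall>j n. n \<ge> 1 \<longrightarrow>
        finite (X j n) \<and> X j n \<noteq> {} \<and> X j n \<subseteq> extensional {..<n} \<and>
        inj_on (lab j n) (X j n) \<and> (\<forall>x\<in>X j n. length (lab j n x) = b j n))"

definition SpAC :: "'m::finite itself \<Rightarrow> nat \<Rightarrow> real" where
  "SpAC _ n = real n / real CARD('m)"

definition achievable ::
  "'m::finite channel \<Rightarrow> (3 \<Rightarrow> nat \<Rightarrow> symbols set) \<Rightarrow> (3 \<Rightarrow> nat \<Rightarrow> nat)
    \<Rightarrow> (3 \<Rightarrow> nat \<Rightarrow> symbols \<Rightarrow> bool list) \<Rightarrow> (3 \<Rightarrow> real) \<Rightarrow> bool" where
  "achievable H X b lab d \<longleftrightarrow>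
     (\<exists>(n :: 3 \<Rightarrow> nat) (Q :: 3 \<Rightarrow> 'm columns).
        (\<forall>j. n j \<ge> 1 \<and> d j = SpAC TYPE('m) (n j) \<and> full_column_rank (n j) (Q j)) \<and>
        (\<forall>i. FIA H n Q i) \<and>
        (\<forall>i. ((\<lambda>s. BER H n Q s i (X i (n i)) (b i (n i)) (lab i (n i))) \<longlongrightarrow> 0) (at_right 0)))"

end

theory Submission
  imports Defs "HOL-Computational_Algebra.Fundamental_Theorem_Algebra" "HOL-Real_Asymp.Real_Asymp"
begin

text \<open>
  Achievability. Describe each precoder with \<open>M - 1\<close> streams by a row vector annihilating its column
  space. Aligning the interference into a hyperplane at all three receivers is then a generalized
  eigenvector problem for two products of cross channel matrices, so it is solvable over the complex
  numbers. If the desired signal fell into the interference at some receiver, the eigenvector would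
  also be an eigenvector of a further matrix involving the direct channel, and the determinant of a
  commutator would vanish. That determinant is a nonzero polynomial in the channel entries, hence
  almost surely nonzero. At each receiver the functional annihilating the interference then takes
  nonzero values on the desired signal, and a Vandermonde choice of the basis of the precoder space
  makes these values differ for distinct symbol vectors. In that direction the covariance
  is only \<open>\<sigma>\<^sup>2\<close>, so all distances in the detection metric grow like \<open>1 / \<sigma>\<^sup>2\<close> while the Gaussian tail
  decays exponentially.

  Converse. With \<open>M\<close> streams of full rank, a transmitter fills the whole space at the unintended
  receivers.
\<close>

subsection \<open>Polynomial functions of independent atomless variables\<close>

text \<open>Functions instead of a type of multivariate polynomials: measurability and the reduction
  to one variable along a coordinate line both follow by rule induction.\<close>

inductive polyfun :: "(('i \<Rightarrow> complex) \<Rightarrow> complex) \<Rightarrow> bool" where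
  coord: "polyfun (\<lambda>x. x i)"
| const: "polyfun (\<lambda>x. c)"
| add: "polyfun f \<Longrightarrow> polyfun g \<Longrightarrow> polyfun (\<lambda>x. f x + g x)"
| mult: "polyfun f \<Longrightarrow> polyfun g \<Longrightarrow> polyfun (\<lambda>x. f x * g x)"

lemma polyfun_diff: "polyfun f \<Longrightarrow> polyfun g \<Longrightarrow> polyfun (\<lambda>x. f x - g x)"
  using polyfun.add[of f "\<lambda>x. (-1) * g x"] polyfun.mult[OF polyfun.const[of "-1"], of g] by simp

lemma polyfun_sum: "(\<And>a. a \<in> A \<Longrightarrow> polyfun (f a)) \<Longrightarrow> polyfun (\<lambda>x. \<Sum>a\<in>A. f a x)"
  by (induction A rule: infinite_finite_induct) (auto intro: polyfun.intros)

lemma polyfun_prod: "(\<And>a. a \<in> A \<Longrightarrow> polyfun (f a)) \<Longrightarrow> polyfun (\<lambda>x. \<Prod>a\<in>A. f a x)"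
  by (induction A rule: infinite_finite_induct) (auto intro: polyfun.intros)

lemma polyfun_line: "polyfun f \<Longrightarrow> \<exists>p. \<forall>t. f (x(i := t)) = poly p t"
proof (induction rule: polyfun.induct)
  case (coord j)
  show ?case
  proof (cases "j = i")
    case True then show ?thesis by (intro exI[of _ "[:0, 1:]"]) auto
  next
    case False then show ?thesis by (intro exI[of _ "[:x j:]"]) auto
  qed
next
  case (const c) show ?case by (intro exI[of _ "[:c:]"]) auto
next
  case (add f g)
  then obtain p q where "\<forall>t. f (x(i := t)) = poly p t" "\<forall>t. g (x(i := t)) = poly q t" by blast
  then show ?case by (intro exI[of _ "p + q"]) (simp del: fun_upd_apply)
next
  case (mult f g)
  then obtain p q where "\<forall>t. f (x(i := t)) = poly p t" "\<forall>t. g (x(i := t)) = poly q t" by blast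
  then show ?case by (intro exI[of _ "p * q"]) (simp del: fun_upd_apply)
qed

lemma polyfun_measurable_override:
  assumes sets: "sets \<mu> = sets borel"
  shows "polyfun f \<Longrightarrow> (\<lambda>x. f (override_on y x I)) \<in> borel_measurable (PiM I (\<lambda>_. \<mu>))"
proof (induction rule: polyfun.induct)
  case (coord i)
  have "(\<lambda>x. x i) \<in> borel_measurable (PiM I (\<lambda>_. \<mu>))" if "i \<in> I"
    using measurable_component_singleton[OF that, of "\<lambda>_. \<mu>"]
      measurable_cong_sets[OF refl sets] by metis
  then show ?case by (cases "i \<in> I") (auto simp: override_on_def)
qed auto

text \<open>Start from a point \<open>y\<close> with \<open>f y \<noteq> 0\<close> and randomise its
  coordinates one at a time. Along each new coordinate \<open>f\<close> is almost surely a nonzero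
  univariate polynomial, whose finitely many roots are null because \<open>\<mu>\<close> has no
  atoms; integrating over the earlier coordinates closes the step.\<close>

lemma AE_polyfun_nonzero:
  assumes prob: "prob_space \<mu>" and sets: "sets \<mu> = sets borel"
    and atomless: "\<And>z. emeasure \<mu> {z} = 0"
    and f: "polyfun f" "f y \<noteq> 0" and I: "finite I"
  shows "AE x in PiM I (\<lambda>_. \<mu>). f (override_on y x I) \<noteq> 0"
  using I
proof (induction I rule: finite_induct)
  case empty
  then show ?case using f by simp
next
  case (insert i I)
  interpret prob_space \<mu> by (rule prob)
  interpret product_sigma_finite "\<lambda>_. \<mu>"
    by unfold_locales
  let ?P = "\<lambda>I. PiM I (\<lambda>_. \<mu>)"
  define N where "N = {x \<in> space (?P (insert i I)). f (override_on y x (insert i I)) = 0}"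
  note polyfun_measurable_override[OF sets f(1), measurable]
  have N: "N \<in> sets (?P (insert i I))"
    unfolding N_def by measurable
  have "AE x in ?P I. (\<integral>\<^sup>+z. indicator N (x(i := z)) \<partial>\<mu>) = 0"
    using insert.IH
  proof eventually_elim
    fix x assume nz: "f (override_on y x I) \<noteq> 0"
    obtain p where p: "\<And>t. f ((override_on y x I)(i := t)) = poly p t"
      using polyfun_line[OF f(1)] by blast
    have ovr: "override_on y (x(i := t)) (insert i I) = (override_on y x I)(i := t)" for t
      using insert.hyps by (auto simp: override_on_def fun_eq_iff)
    \<comment> \<open>Coordinate \<open>i\<close> is still frozen at \<open>y i\<close>, and at that
      value the line passes through a point where \<open>f\<close> is nonzero. Hence
      \<open>p\<close> is not the zero polynomial.\<close>
    have "poly p (override_on y x I i) \<noteq> 0"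
      using nz p[of "override_on y x I i"] by simp
    then have "finite {t. poly p t = 0}" by (intro poly_roots_finite) auto
    then have "emeasure \<mu> {t. poly p t = 0} = 0"
      by (subst emeasure_eq_sum_singleton) (auto simp: sets atomless)
    moreover have "(\<integral>\<^sup>+z. indicator N (x(i := z)) \<partial>\<mu>) \<le> (\<integral>\<^sup>+z. indicator {t. poly p t = 0} z \<partial>\<mu>)"
      by (intro nn_integral_mono) (auto simp: N_def ovr p split: split_indicator)
    moreover have "{t. poly p t = 0} \<in> sets \<mu>"
      using \<open>finite {t. poly p t = 0}\<close> by (simp add: sets finite_imp_closed)
    ultimately show "(\<integral>\<^sup>+z. indicator N (x(i := z)) \<partial>\<mu>) = 0" by simp
  qed
  then have "(\<integral>\<^sup>+x. \<integral>\<^sup>+z. indicator N (x(i := z)) \<partial>\<mu> \<partial>?P I) = (\<integral>\<^sup>+x. 0 \<partial>?P I)"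
    by (rule nn_integral_cong_AE)
  then have "emeasure (?P (insert i I)) N = 0"
    using product_nn_integral_insert[of I i "indicator N"] insert.hyps N by simp
  then show ?case
    using N by (intro AE_I[where N = N]) (auto simp: N_def)
qed

section \<open>Matrices with polynomial entries and the adjugate\<close>

definition polymat :: "(('i \<Rightarrow> complex) \<Rightarrow> complex ^ 'n ^ 'm) \<Rightarrow> bool" where
  "polymat A \<longleftrightarrow> (\<forall>a c. polyfun (\<lambda>x. A x $ a $ c))"

lemma polyfun_det: "polymat A \<Longrightarrow> polyfun (\<lambda>x. det (A x))"
  unfolding det_def polymat_def by (intro polyfun_sum polyfun.mult polyfun.const polyfun_prod) auto

lemma polymat_mult: "polymat A \<Longrightarrow> polymat B \<Longrightarrow> polymat (\<lambda>x. A x ** B x)"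
  unfolding matrix_matrix_mult_def polymat_def by (auto intro!: polyfun_sum polyfun.mult)

lemma polymat_diff: "polymat A \<Longrightarrow> polymat B \<Longrightarrow> polymat (\<lambda>x. A x - B x)"
  unfolding polymat_def by (auto intro: polyfun_diff)

text \<open>The classical adjugate, written with Cramer's determinants: its entries are visibly
  polynomial in those of \<open>A\<close>, and \<open>cramer\<close> yields the inverse relation
  directly.\<close>

definition adjugate :: "complex ^ 'n ^ 'n \<Rightarrow> complex ^ 'n ^ 'n::finite" where
  "adjugate A = (\<chi> k c. det (\<chi> i j. if j = k then (axis c 1 :: complex ^ 'n) $ i else A $ i $ j))"

lemma polymat_adjugate:
  fixes A :: "('i \<Rightarrow> complex) \<Rightarrow> complex ^ 'n ^ 'n"
  assumes "polymat A"
  shows "polymat (\<lambda>x. adjugate (A x))"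
  unfolding polymat_def adjugate_def vec_lambda_beta
proof (intro allI polyfun_det)
  show "polymat (\<lambda>x. \<chi> i j. if j = k then (axis c 1 :: complex ^ 'n) $ i else A x $ i $ j)"
    for k c
    unfolding polymat_def
  proof (intro allI)
    show "polyfun (\<lambda>x. (\<chi> i j. if j = k then (axis c 1 :: complex ^ 'n) $ i else A x $ i $ j) $ a $ e)"
      for a e using assms by (cases "e = k") (auto simp: polymat_def polyfun.const)
  qed
qed

lemma mult_adjugate:
  assumes "det A \<noteq> 0"
  shows "A ** adjugate A = mat (det A)"
proof -
  have "A *v (\<chi> k. adjugate A $ k $ c / det A) = axis c 1" for c
    by (subst cramer[OF assms]) (simp add: adjugate_def)
  then have "(\<Sum>k\<in>UNIV. A $ i $ k * adjugate A $ k $ c) / det A = axis c 1 $ i" for i c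
    by (simp add: matrix_vector_mult_def vec_eq_iff sum_divide_distrib)
  then show ?thesis
    using assms by (auto simp: matrix_matrix_mult_def vec_eq_iff mat_def axis_def field_simps)
qed

lemma adjugate_mat_1 [simp]: "adjugate (mat 1 :: complex ^ 'n ^ 'n::finite) = mat 1"
  using mult_adjugate[of "mat 1 :: complex ^ 'n ^ 'n"] by simp

lemma det_adjugate_nonzero:
  assumes "det A \<noteq> 0"
  shows "det (adjugate A) \<noteq> 0"
proof
  assume "det (adjugate A) = 0"
  then have "det (mat (det A) :: complex ^ 'a ^ 'a) = 0"
    using mult_adjugate[OF assms] by (metis det_mul mult_zero_right)
  then show False using assms by (simp add: det_diagonal mat_def)
qed

subsection \<open>Interference alignment for generic channels\<close>

lemma mat_mult_nth [simp]: "(mat c ** A) $ i $ j = c * (A :: complex ^ 'n ^ 'm::finite) $ i $ j"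
  by (simp add: matrix_matrix_mult_def mat_def if_distrib if_distribR cong: if_cong)

lemma mult_mat_nth [simp]: "(A ** mat c) $ i $ j = (A :: complex ^ 'n::finite ^ 'm) $ i $ j * c"
  by (simp add: matrix_matrix_mult_def mat_def if_distrib if_distribR cong: if_cong)

lemma mat_mult_commute: "A ** mat c = mat c ** (A :: complex ^ 'n ^ 'n::finite)"
  by (simp add: vec_eq_iff)

lemma mat_mult_mat: "mat c ** mat d = (mat (c * d) :: complex ^ 'n ^ 'n::finite)"
  by (simp add: vec_eq_iff) (simp add: mat_def)

text \<open>After scaling by \<open>1 / det A\<close>: a right inverse of a square matrix is also a
  left inverse.\<close>

lemma adjugate_mult:
  assumes "det A \<noteq> 0"
  shows "adjugate A ** A = mat (det A)"
proof -
  have "A ** (mat (1 / det A) ** adjugate A) = mat 1"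
    using assms by (simp add: matrix_mul_assoc mat_mult_commute)
      (simp add: mult_adjugate mat_mult_mat flip: matrix_mul_assoc)
  then have "mat (1 / det A) ** adjugate A ** A = mat 1"
    by (rule matrix_left_right_inverse1)
  then have "mat (det A) ** mat (1 / det A) ** (adjugate A ** A) = mat (det A)"
    by (metis matrix_mul_assoc matrix_mul_rid)
  then show ?thesis using assms by (simp add: mat_mult_mat)
qed

lemma vector_mat_mult: "p v* mat c = c *s (p :: complex ^ 'n::finite)"
  by (simp add: vec_eq_iff vector_matrix_mult_def mat_def if_distrib cong: if_cong)

lemma det_mat: "det (mat c :: complex ^ 'n ^ 'n::finite) = c ^ CARD('n)"
  by (simp add: det_diagonal mat_def)

lemma det_eq_0_iff_kernel:
  fixes A :: "complex ^ 'n ^ 'n::finite"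
  shows "det A = 0 \<longleftrightarrow> (\<exists>x. x \<noteq> 0 \<and> A *v x = 0)"
  using matrix_left_invertible_ker[of A] invertible_det_nz[of A] invertible_left_inverse[of A] by blast

lemma det_eq_0_iff_left_kernel:
  fixes A :: "complex ^ 'n ^ 'n::finite"
  shows "det A = 0 \<longleftrightarrow> (\<exists>p. p \<noteq> 0 \<and> p v* A = 0)"
  using det_eq_0_iff_kernel[of "transpose A"] by (simp add: det_transpose)

text \<open>A root \<open>z\<close> of \<open>det (S - z T)\<close> gives the vector. If there were
  no root, the fundamental theorem of algebra would make both this polynomial and its reversal
  \<open>det (t S - T)\<close> constant, which their relation by the factor
  \<open>t ^ CARD('n)\<close> forbids. No degree or leading coefficient has to be computed.\<close>

lemma generalized_left_eigenvector:
  fixes S T :: "complex ^ 'n ^ 'n::finite"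
  assumes T: "det T \<noteq> 0"
  obtains p c where "p \<noteq> 0" "p v* S = c *s (p v* T)"
proof (cases "\<exists>z. det (S - mat z ** T) = 0")
  case True
  then obtain z p where p: "p \<noteq> 0" "p v* (S - mat z ** T) = 0"
    unfolding det_eq_0_iff_left_kernel by blast
  have "p v* (S - mat z ** T) = p v* S - (p v* mat z) v* T"
    by (simp add: vector_matrix_mult_diff_rdistrib vector_matrix_mul_assoc)
  then have "p v* S = z *s (p v* T)"
    using p(2) by (simp add: vector_mat_mult scalar_vector_matrix_assoc)
  with p(1) show ?thesis by (rule that)
next
  case False
  have line: "\<exists>p. \<forall>t. det (A + mat t ** B) = poly p t" for A B :: "complex ^ 'n ^ 'n"
  proof -
    have "polymat (\<lambda>x. A + mat (x ()) ** B)"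
      unfolding polymat_def
      by (auto intro!: polyfun.intros)
    from polyfun_line[OF polyfun_det[OF this], of "\<lambda>_. 0" "()"] show ?thesis by simp
  qed
  have const: "det (A + mat s ** B) = det (A + mat t ** B)"
    if "\<And>z. det (A + mat z ** B) \<noteq> 0" for A B :: "complex ^ 'n ^ 'n" and s t
  proof -
    obtain p where p: "\<And>t. det (A + mat t ** B) = poly p t" using line by blast
    then have "constant (poly p)"
      using fundamental_theorem_of_algebra[of p] that by auto
    then show ?thesis unfolding p constant_def by blast
  qed
  have neg: "A + mat z ** (- B) = A - mat z ** B" for A B :: "complex ^ 'n ^ 'n" and z
    by (simp add: vec_eq_iff matrix_matrix_mult_def sum_negf)
  have scale: "mat t ** S - T = mat t ** (S - mat (1 / t) ** T)" if "t \<noteq> 0" for t :: complex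
    using that by (simp add: vec_eq_iff algebra_simps)
  have sc: "det (mat t ** S - T) = t ^ CARD('n) * det (S - mat (1 / t) ** T)" if "t \<noteq> 0" for t :: complex
    by (simp add: scale[OF that] det_mul det_mat)
  have neg': "- T + mat t ** S = mat t ** S - T" for t by simp
  have mT: "- T = mat (- 1) ** T"
    by (simp add: vec_eq_iff algebra_simps)
  \<comment> \<open>For nonzero \<open>t\<close> the reversed pencil is a rescaling of the original
    one; at \<open>t = 0\<close> it is \<open>- T\<close>, which is where the invertibility of
    \<open>T\<close> enters.\<close>
  have "det (mat t ** S - T) \<noteq> 0" for t
  proof (cases "t = 0")
    case True
    have "det (- T) \<noteq> 0"
      unfolding mT det_mul det_mat using T by simp
    moreover have "mat 0 ** S - T = - T"
      by (simp add: vec_eq_iff algebra_simps)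
    ultimately show ?thesis using True by simp
  next
    case False
    then show ?thesis using \<open>\<not> (\<exists>z. det (S - mat z ** T) = 0)\<close> by (simp add: sc)
  qed
  then have "det (mat 1 ** S - T) = det (mat 2 ** S - T)"
    using const[of "- T" S 1 2] by (simp add: neg')
  moreover have "det (S - mat 1 ** T) = det (S - mat (1/2) ** T)"
    using const[of S "- T" 1 "1/2"] False by (simp add: neg)
  \<comment> \<open>Both determinants are constant and nonzero, so the factor
    \<open>t ^ CARD('n)\<close> takes the same value at \<open>t = 1\<close> and
    \<open>t = 2\<close>.\<close>
  ultimately have "(2::complex) ^ CARD('n) = 1"
    using sc[of 1] sc[of 2] False by simp
  then have "(2::nat) ^ CARD('n) = 1"
    by (metis of_nat_1 of_nat_eq_iff of_nat_numeral of_nat_power)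
  then show ?thesis by simp
qed

text \<open>
  Multiplication by \<open>X Z\<^sup>-\<^sup>1\<close> and \<open>Y Z\<^sup>-\<^sup>1\<close> acts on \<open>p\<close> by scalars, so \<open>p\<close> annihilates their commutator. This
  turns a condition on an unknown eigenvector into a polynomial condition on the channel entries.
\<close>

lemma common_direction_imp_singular:
  fixes X Y Z :: "complex ^ 'n ^ 'n::finite"
  assumes "det Z \<noteq> 0" "p \<noteq> 0" "p v* X = a *s (p v* Z)" "p v* Y = b *s (p v* Z)"
  shows "det (X ** adjugate Z ** Y - Y ** adjugate Z ** X) = 0"
  unfolding det_eq_0_iff_left_kernel
proof (intro exI conjI)
  have "p v* (A ** adjugate Z ** B) = (a * det Z * b) *s (p v* Z)"
    if "p v* A = a *s (p v* Z)" "p v* B = b *s (p v* Z)" for A B a b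
  proof -
    have "p v* (A ** adjugate Z ** B) = a *s (p v* (Z ** adjugate Z) v* B)"
      using that(1) by (simp add: scalar_vector_matrix_assoc flip: vector_matrix_mul_assoc)
    also have "\<dots> = (a * det Z) *s (p v* B)"
      by (simp add: mult_adjugate[OF assms(1)] vector_mat_mult scalar_vector_matrix_assoc)
    finally show ?thesis using that(2) by (simp add: mult.assoc)
  qed
  from this[OF assms(3,4)] this[OF assms(4,3)]
  show "p v* (X ** adjugate Z ** Y - Y ** adjugate Z ** X) = 0"
    by (simp add: vector_matrix_mult_diff_rdistrib mult_ac)
qed (fact assms)

text \<open>
  Let \<open>p\<close> be a row vector annihilating the interference at receiver 1. Alignment at receiver 1
  makes \<open>p H\<^sub>1\<^sub>2\<close> and \<open>p H\<^sub>1\<^sub>3\<close> annihilate the precoders of users 2 and 3. Alignment at receivers 2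
  and 3 makes \<open>p H\<^sub>1\<^sub>3 H\<^sub>2\<^sub>3\<^sup>-\<^sup>1 H\<^sub>2\<^sub>1\<close> and \<open>p H\<^sub>1\<^sub>2 H\<^sub>3\<^sub>2\<^sup>-\<^sup>1 H\<^sub>3\<^sub>1\<close> annihilate the precoder of user 1, so
  they must be parallel. Adjugates replace inverses to keep all entries polynomial. The desired
  signal at receiver \<open>i\<close> lies inside the interference iff \<open>p direct\<^sub>i\<close> is parallel to \<open>p loop2\<close>.
\<close>

definition loop1 :: "'m channel \<Rightarrow> complex ^ 'm ^ 'm::finite" where
  "loop1 h = h 1 3 ** adjugate (h 2 3) ** h 2 1"
definition loop2 :: "'m channel \<Rightarrow> complex ^ 'm ^ 'm::finite" where
  "loop2 h = h 1 2 ** adjugate (h 3 2) ** h 3 1"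
definition direct :: "3 \<Rightarrow> 'm channel \<Rightarrow> complex ^ 'm ^ 'm::finite" where
  "direct i h =
     (if i = 1 then h 1 1
      else if i = 2 then h 1 3 ** adjugate (h 2 3) ** h 2 2 ** adjugate (h 3 2) ** h 3 1
      else h 1 2 ** adjugate (h 3 2) ** h 3 3 ** adjugate (h 2 3) ** h 2 1)"
definition obstruction :: "3 \<Rightarrow> 'm channel \<Rightarrow> complex ^ 'm ^ 'm::finite" where
  "obstruction i h = direct i h ** adjugate (loop2 h) ** loop1 h - loop1 h ** adjugate (loop2 h) ** direct i h"

text \<open>Finitely many polynomial inequations in the channel entries. Probability enters the
  argument only through the fact that they hold almost surely; everything else is
  deterministic.\<close>

definition generic :: "'m::finite channel \<Rightarrow> bool" where
  "generic h \<longleftrightarrow> (\<forall>i j. det (h i j) \<noteq> 0) \<and> (\<forall>i. det (obstruction i h) \<noteq> 0)"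

lemma left_mult_nonzero:
  fixes A :: "complex ^ 'n ^ 'n::finite"
  shows "det A \<noteq> 0 \<Longrightarrow> p \<noteq> 0 \<Longrightarrow> p v* A \<noteq> 0"
  using det_eq_0_iff_left_kernel by blast

text \<open>The kernel of \<open>\<phi> j\<close> is to become the column space of precoder
  \<open>j\<close>, and the kernel of \<open>\<psi> i\<close> the interference space at receiver
  \<open>i\<close>. The second property is then alignment, the third says that the desired signal
  leaves the interference space.\<close>

lemma alignment:
  fixes h :: "'m::finite channel"
  assumes "generic h"
  obtains \<phi> \<psi> :: "3 \<Rightarrow> complex ^ 'm" where
    "\<And>i. \<phi> i \<noteq> 0"
    "\<And>i j. i \<noteq> j \<Longrightarrow> \<exists>c. \<psi> i v* h i j = c *s \<phi> j"
    "\<And>i c. \<psi> i v* h i i \<noteq> c *s \<phi> i"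
proof -
  have nz: "det (h i j) \<noteq> 0" for i j
    using assms by (auto simp: generic_def)
  have ob: "det (obstruction i h) \<noteq> 0" for i
    using assms by (auto simp: generic_def)
  note adj_nz = det_adjugate_nonzero[OF nz]
  have l1: "det (loop1 h) \<noteq> 0" and l2: "det (loop2 h) \<noteq> 0"
    by (simp_all add: loop1_def loop2_def det_mul nz adj_nz)
  obtain p z where p: "p \<noteq> 0" "p v* loop1 h = z *s (p v* loop2 h)"
    using generalized_left_eigenvector[OF l2] by blast
  \<comment> \<open>Receiver 3 reaches \<open>\<phi> 1\<close> only up to the factor
    \<open>1 / z\<close>.\<close>
  have z: "z \<noteq> 0"
    using left_mult_nonzero[OF l1 p(1)] p(2) by auto
  define \<phi> where "\<phi> = (\<lambda>i :: 3. if i = 1 then p v* loop1 h else if i = 2 then p v* h 1 2 else p v* h 1 3)"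
  define \<psi> where "\<psi> = (\<lambda>i :: 3. if i = 1 then p else if i = 2 then p v* h 1 3 v* adjugate (h 2 3)
     else p v* h 1 2 v* adjugate (h 3 2))"
  have no: "p v* direct i h \<noteq> c *s (p v* loop2 h)" for i c
    using common_direction_imp_singular[OF l2 p(1) _ p(2), of "direct i h" c] ob[of i]
    by (auto simp: obstruction_def)
  show thesis
  proof (rule that[of \<phi> \<psi>])
    show "\<phi> i \<noteq> 0" for i
      by (simp add: \<phi>_def left_mult_nonzero l1 p(1) nz)
  next
    have 1: "\<psi> 1 v* h 1 2 = 1 *s \<phi> 2" "\<psi> 1 v* h 1 3 = 1 *s \<phi> 3" "\<psi> 2 v* h 2 1 = 1 *s \<phi> 1"
      by (simp_all add: \<phi>_def \<psi>_def loop1_def vector_matrix_mul_assoc)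
    have 2: "\<psi> 2 v* h 2 3 = det (h 2 3) *s \<phi> 3" "\<psi> 3 v* h 3 2 = det (h 3 2) *s \<phi> 2"
      by (simp_all add: \<phi>_def \<psi>_def vector_matrix_mul_assoc adjugate_mult[OF nz] vector_mat_mult
          flip: matrix_mul_assoc) (simp_all add: vector_mat_mult flip: vector_matrix_mul_assoc)
    have 3: "\<psi> 3 v* h 3 1 = (1 / z) *s \<phi> 1"
      using z by (simp add: \<phi>_def \<psi>_def p(2) loop2_def vector_matrix_mul_assoc)
    have "\<forall>i j. i \<noteq> j \<longrightarrow> (\<exists>c. \<psi> i v* h i j = c *s \<phi> j)"
      unfolding forall_3 using 1 2 3 by blast
    then show "\<exists>c. \<psi> i v* h i j = c *s \<phi> j" if "i \<noteq> j" for i j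
      using that by blast
  next
    fix i :: 3 and c
    show "\<psi> i v* h i i \<noteq> c *s \<phi> i"
    proof
      assume eq: "\<psi> i v* h i i = c *s \<phi> i"
      consider "i = 1" | "i = 2" | "i = 3" using exhaust_3 by blast
      then show False
      proof cases
        case 1
        then show False using eq no[of 1 "c * z"] by (simp add: \<phi>_def \<psi>_def direct_def p(2) del: vector_mul_rcancel)
      next
        case 2
        \<comment> \<open>Right multiplication by \<open>adjugate (h 3 2) ** h 3 1\<close> carries
          \<open>\<phi> 2\<close> to \<open>p v* loop2 h\<close>, so a parallel direct signal at
          receiver 2 becomes the excluded relation for \<open>direct 2 h\<close>. Receiver 3 is
          treated alike, with \<open>loop1 h\<close> and the extra eigenvalue
          \<open>z\<close>.\<close>
        have "p v* direct 2 h = (\<psi> 2 v* h 2 2) v* (adjugate (h 3 2) ** h 3 1)"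
          by (simp add: \<psi>_def direct_def vector_matrix_mul_assoc matrix_mul_assoc)
        also have "\<dots> = c *s (p v* loop2 h)"
          using eq 2 by (simp add: \<phi>_def scalar_vector_matrix_assoc loop2_def vector_matrix_mul_assoc matrix_mul_assoc)
        finally show False using no by blast
      next
        case 3
        have "p v* direct 3 h = (\<psi> 3 v* h 3 3) v* (adjugate (h 2 3) ** h 2 1)"
          by (simp add: \<psi>_def direct_def vector_matrix_mul_assoc matrix_mul_assoc)
        also have "\<dots> = c *s (p v* loop1 h)"
          using eq 3 by (simp add: \<phi>_def scalar_vector_matrix_assoc loop1_def vector_matrix_mul_assoc matrix_mul_assoc)
        finally show False using no[of 3 "c * z"] by (simp add: p(2))
      qed
    qed
  qed
qed

section \<open>A channel whose obstructions are all nonsingular\<close>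

lemma fixpoint_free_surj:
  assumes "CARD('m::finite) \<ge> 2"
  obtains \<pi> :: "'m::finite \<Rightarrow> 'm" and d :: "'m::finite \<Rightarrow> nat" where "surj \<pi>" "\<And>a. \<pi> a \<noteq> a" "inj d"
proof -
  let ?M = "CARD('m)"
  obtain f where f: "bij_betw f (UNIV :: 'm set) {0..<?M}"
    using ex_bij_betw_finite_nat[of "UNIV :: 'm set"] by auto
  define g where "g = inv_into UNIV f"
  have fg: "f (g k) = k" if "k < ?M" for k
    using f that unfolding g_def by (intro f_inv_into_f) (auto simp: bij_betw_def)
  have gf: "g (f a) = a" for a
    using f unfolding g_def by (intro inv_into_f_f) (auto simp: bij_betw_def)
  have fl: "f a < ?M" for a using f by (auto simp: bij_betw_def)
  have "surj (\<lambda>a. g ((f a + 1) mod ?M))"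
  proof (rule surjI)
    fix b
    \<comment> \<open>The map is a cyclic shift of an enumeration; advancing by
      \<open>?M - 1\<close> places undoes it.\<close>
    have "(((f b + (?M - 1)) mod ?M) + 1) mod ?M = (f b + (?M - 1) + 1) mod ?M"
      by (rule mod_add_left_eq)
    also have "\<dots> = f b" using fl[of b] assms by simp
    finally show "g ((f (g ((f b + (?M - 1)) mod ?M)) + 1) mod ?M) = b"
      using fl[of b] by (simp add: fg gf)
  qed
  moreover have "g ((f a + 1) mod ?M) \<noteq> a" for a
  proof
    assume "g ((f a + 1) mod ?M) = a"
    then have "(f a + 1) mod ?M = f a" using fg[of "(f a + 1) mod ?M"] by simp
    \<comment> \<open>Only a wrap-around to 0 could fix \<open>a\<close>, and it would force
      \<open>?M = 1\<close>.\<close>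
    then show False using fl[of a] assms by (cases "f a + 1 = ?M") (simp_all add: mod_less)
  qed
  moreover have "inj f" using f by (simp add: bij_betw_def)
  ultimately show thesis by (rule that)
qed

text \<open>The commutator of a diagonal matrix \<open>D\<close> with distinct entries and a
  permutation matrix \<open>C\<close> without fixed points has the nonzero entries
  \<open>d a - d (\<pi> a)\<close> exactly where \<open>C\<close> has its ones, hence is
  nonsingular. The channel is chosen so that every obstruction reduces to it.\<close>

lemma generic_witness:
  assumes "CARD('m::finite) \<ge> 2"
  shows "\<exists>h :: 'm::finite channel. \<forall>i. det (obstruction i h) \<noteq> 0"
proof -
  obtain \<pi> :: "'m \<Rightarrow> 'm" and d :: "'m \<Rightarrow> nat" where pd: "surj \<pi>" "\<And>a. \<pi> a \<noteq> a" "inj d"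
    using fixpoint_free_surj[OF assms] by blast
  define D :: "complex ^ 'm ^ 'm" where "D = (\<chi> a c. if a = c then of_nat (d a) else 0)"
  define C :: "complex ^ 'm ^ 'm" where "C = (\<chi> a c. if c = \<pi> a then 1 else 0)"
  have C: "det C \<noteq> 0"
    unfolding det_eq_0_iff_kernel
  proof safe
    fix x assume nz: "x \<noteq> 0" and "C *v x = 0"
    then have "x $ \<pi> a = 0" for a
      by (simp add: C_def vec_eq_iff matrix_vector_mult_def if_distrib if_distribR cong: if_cong)
    then have "x $ b = 0" for b
      using pd(1) by (metis surjD)
    then show False using nz by (simp add: vec_eq_iff)
  qed
  have DC: "det (D ** C - C ** D) \<noteq> 0"
    unfolding det_eq_0_iff_kernel
  proof safe
    fix x assume nz: "x \<noteq> 0" and x: "(D ** C - C ** D) *v x = 0"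
    have 1: "(D ** C) $ a $ c = of_nat (d a) * C $ a $ c" for a c
      by (simp add: D_def matrix_matrix_mult_def if_distrib[where f = "\<lambda>x. x * y" for y] cong: if_cong)
    have 2: "(C ** D) $ a $ c = C $ a $ c * of_nat (d c)" for a c
      by (simp add: D_def matrix_matrix_mult_def if_distrib cong: if_cong)
    have "(D ** C - C ** D) $ a $ c = (if c = \<pi> a then of_nat (d a) - of_nat (d c) else 0)" for a c
      by (simp add: 1 2) (simp add: C_def)
    then have "((D ** C - C ** D) *v x) $ a = (\<Sum>c\<in>UNIV. if c = \<pi> a then (of_nat (d a) - of_nat (d c)) * x $ c else 0)" for a
      unfolding matrix_vector_mult_def vec_lambda_beta
      by (intro sum.cong) auto
    then have "((D ** C - C ** D) *v x) $ a = (of_nat (d a) - of_nat (d (\<pi> a))) * x $ \<pi> a" for a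
      by simp
    then have eq: "(of_nat (d a) - of_nat (d (\<pi> a))) * x $ \<pi> a = 0" for a
      using x by simp
    have "x $ \<pi> a = 0" for a
      using eq[of a] pd(2)[of a] inj_eq[OF pd(3), of a "\<pi> a"] by simp
    then have "x $ b = 0" for b
      using pd(1) by (metis surjD)
    then show False using nz by (simp add: vec_eq_iff)
  qed
  define h :: "'m channel" where
    "h = (\<lambda>i j. if i = j then D else if i = 2 \<and> j = 1 then C else mat 1)"
  show ?thesis
  proof (intro exI allI)
    \<comment> \<open>Here \<open>loop2 h\<close> is the identity and \<open>loop1 h\<close> is
      \<open>C\<close>. The three direct matrices are \<open>D\<close>, \<open>D\<close> and
      \<open>D ** C\<close>, so the third obstruction is the commutator times
      \<open>C\<close>.\<close>
    have "(A - B) ** E = A ** E - B ** E" for A B E :: "complex ^ 'm ^ 'm"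
      by (simp add: vec_eq_iff matrix_matrix_mult_def sum_subtractf left_diff_distrib)
    then have "D ** C ** C - C ** D ** C = (D ** C - C ** D) ** C" by simp
    then show "det (obstruction i h) \<noteq> 0" for i
      using C DC exhaust_3[of i] by (auto simp: obstruction_def direct_def loop1_def loop2_def h_def det_mul matrix_mul_assoc)
  qed
qed

subsection \<open>Hyperplanes with prescribed functional values\<close>

text \<open>Bilinear, without conjugation: row vectors act as linear functionals. The sesquilinear
  counterpart is \<open>cinner\<close>.\<close>

definition dotp :: "complex ^ 'n \<Rightarrow> complex ^ 'n::finite \<Rightarrow> complex" where
  "dotp u w = (\<Sum>a\<in>UNIV. u $ a * w $ a)"

lemma dotp_zero_right [simp]: "dotp u 0 = 0"
  and dotp_add_right: "dotp u (v + w) = dotp u v + dotp u w"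
  and dotp_diff_right: "dotp u (v - w) = dotp u v - dotp u w"
  and dotp_scale_right: "dotp u (c *s w) = c * dotp u w"
  and dotp_scale_left: "dotp (c *s u) w = c * dotp u w"
  by (simp_all add: dotp_def algebra_simps sum.distrib sum_subtractf sum_distrib_left)

lemma dotp_sum_right: "dotp u (\<Sum>k\<in>K. f k) = (\<Sum>k\<in>K. dotp u (f k))"
  by (induction K rule: infinite_finite_induct) (simp_all add: dotp_add_right)

lemma dotp_axis [simp]: "dotp u (axis a 1) = u $ a"
  by (simp add: dotp_def axis_def if_distrib cong: if_cong)

lemma dotp_vector_matrix_mult: "dotp (p v* A) w = dotp p (A *v w)"
  by (simp add: dotp_def vector_matrix_mult_def matrix_vector_mult_def sum_distrib_left
      sum_distrib_right mult.assoc) (rule sum.swap)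

lemma dotp_eq_1:
  assumes "\<phi> \<noteq> 0"
  obtains e where "dotp \<phi> e = 1"
proof -
  obtain a where "\<phi> $ a \<noteq> 0" using assms by (auto simp: vec_eq_iff)
  then have "dotp \<phi> ((1 / \<phi> $ a) *s axis a 1) = 1" by (simp add: dotp_scale_right)
  then show thesis by (rule that)
qed

abbreviation hyperplane :: "complex ^ 'n \<Rightarrow> (complex ^ 'n::finite) set" where
  "hyperplane \<phi> \<equiv> {w. dotp \<phi> w = 0}"

lemma subspace_hyperplane: "vec.subspace (hyperplane \<phi>)"
  by (intro vec.subspaceI) (auto simp: dotp_add_right dotp_scale_right)

text \<open>One vector on which \<open>\<phi>\<close> is 1 completes the kernel to the whole
  space.\<close>

lemma dim_hyperplane_complex:
  fixes \<phi> :: "complex ^ 'n::finite"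
  assumes "\<phi> \<noteq> 0"
  shows "vec.dim (hyperplane \<phi>) = CARD('n) - 1"
proof -
  obtain e where e: "dotp \<phi> e = 1" using dotp_eq_1[OF assms] by blast
  have sp: "vec.span (hyperplane \<phi>) = hyperplane \<phi>"
    using subspace_hyperplane by (rule vec.span_eq_iff[THEN iffD2])
  have "w \<in> vec.span (insert e (hyperplane \<phi>))" for w
    unfolding vec.span_insert sp
    using e by (auto intro!: exI[of _ "dotp \<phi> w"] simp: dotp_diff_right dotp_scale_right)
  then have "vec.span (insert e (hyperplane \<phi>)) = UNIV" by blast
  then have "vec.dim (insert e (hyperplane \<phi>)) = CARD('n)"
    by (metis vec.dim_span vec_dim_card)
  moreover have "e \<notin> vec.span (hyperplane \<phi>)" using e by (simp add: sp)
  ultimately show ?thesis by (simp add: vec.dim_insert)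
qed

text \<open>A functional vanishing on the kernel of \<open>\<phi>\<close> is a multiple of
  \<open>\<phi>\<close>.\<close>

lemma nonparallel_separation:
  fixes \<phi> \<theta> :: "complex ^ 'n::finite"
  assumes "\<phi> \<noteq> 0" "\<And>c. \<theta> \<noteq> c *s \<phi>"
  obtains v where "dotp \<phi> v = 0" "dotp \<theta> v = 1"
proof -
  obtain e where e: "dotp \<phi> e = 1" using dotp_eq_1[OF assms(1)] by blast
  have "\<exists>v. dotp \<phi> v = 0 \<and> dotp \<theta> v \<noteq> 0"
  proof (rule ccontr)
    assume "\<nexists>v. dotp \<phi> v = 0 \<and> dotp \<theta> v \<noteq> 0"
    moreover have "dotp \<phi> (w - dotp \<phi> w *s e) = 0" for w
      using e by (simp add: dotp_diff_right dotp_scale_right)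
    ultimately have ker: "dotp \<theta> (w - dotp \<phi> w *s e) = 0" for w by blast
    have "\<theta> $ a = (dotp \<theta> e *s \<phi>) $ a" for a
      using ker[of "axis a 1"] by (simp add: dotp_diff_right dotp_scale_right mult.commute)
    then have "\<theta> = dotp \<theta> e *s \<phi>" by (simp only: vec_eq_iff simp_thms)
    with assms(2) show False by blast
  qed
  then obtain v where "dotp \<phi> v = 0" "dotp \<theta> v \<noteq> 0" by blast
  then show thesis
    by (intro that[of "(1 / dotp \<theta> v) *s v"]) (simp_all add: dotp_scale_right)
qed

text \<open>Take a basis of the kernel of \<open>\<phi>\<close> that contains some \<open>v\<close>
  with \<open>\<theta>\<close>-value 1, and correct each basis vector by a multiple of
  \<open>v\<close>. With the values \<open>t ^ l\<close>, the functional \<open>\<theta>\<close>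
  turns a symbol vector into a polynomial evaluated at \<open>t\<close>.\<close>

lemma hyperplane_vandermonde_basis:
  fixes \<phi> \<theta> :: "complex ^ 'n::finite"
  assumes "\<phi> \<noteq> 0" "\<And>c. \<theta> \<noteq> c *s \<phi>" "t \<noteq> 0"
  obtains q where "vec.span (q ` {..<CARD('n) - 1}) = hyperplane \<phi>"
    "\<And>l. l < CARD('n) - 1 \<Longrightarrow> dotp \<theta> (q l) = t ^ l"
proof -
  obtain v where v: "dotp \<phi> v = 0" "dotp \<theta> v = 1"
    using nonparallel_separation[OF assms(1,2)] by blast
  have "vec.independent {v}" using v by (auto simp: vec.dependent_single)
  then obtain B where B: "{v} \<subseteq> B" "B \<subseteq> hyperplane \<phi>" "vec.independent B" "hyperplane \<phi> \<subseteq> vec.span B"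
    using vec.maximal_independent_subset_extend[of "{v}" "hyperplane \<phi>"] v by auto
  have "finite B" using B(3) by (rule vec.finiteI_independent)
  have "card B = CARD('n) - 1"
    using vec.basis_card_eq_dim[OF B(2,4,3)] dim_hyperplane_complex[OF assms(1)] by simp
  then obtain f where f: "bij_betw f {..<CARD('n) - 1} B"
    using ex_bij_betw_nat_finite[OF \<open>finite B\<close>] by (auto simp: lessThan_atLeast0)
  then have fB: "f ` {..<CARD('n) - 1} = B" by (simp add: bij_betw_def)
  define q where "q = (\<lambda>l. f l + (t ^ l - dotp \<theta> (f l)) *s v)"
  let ?S = "vec.span (q ` {..<CARD('n) - 1})"
  obtain k where k: "k < CARD('n) - 1" "f k = v" using fB B(1) by auto
  have "q k \<in> ?S" using k by (intro vec.span_base) auto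
  then have "(1 / t ^ k) *s q k \<in> ?S" by (rule vec.span_scale)
  \<comment> \<open>The basis element \<open>v\<close> itself turns into \<open>t ^ k *s v\<close>.
    As \<open>t\<close> is nonzero, \<open>v\<close> remains in the span, and with it every original
    basis vector.\<close>
  moreover have "q k = t ^ k *s v"
    using k(2) v by (simp add: q_def vector_sub_rdistrib)
  then have "(1 / t ^ k) *s q k = v"
    using assms(3) by simp
  ultimately have vS: "v \<in> ?S" by simp
  have "f l \<in> ?S" if "l < CARD('n) - 1" for l
  proof -
    have "q l - (t ^ l - dotp \<theta> (f l)) *s v \<in> ?S"
      using that by (intro vec.span_diff vec.span_scale vS vec.span_base) auto
    then show ?thesis by (simp add: q_def)
  qed
  then have "vec.span B \<subseteq> ?S"
    using fB by (intro vec.span_minimal) auto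
  moreover have "dotp \<phi> (f l) = 0" if "l < CARD('n) - 1" for l
    using that fB B(2) by blast
  then have "?S \<subseteq> hyperplane \<phi>"
    using v by (intro vec.span_minimal subspace_hyperplane)
      (auto simp: q_def dotp_add_right dotp_scale_right vector_sub_rdistrib dotp_diff_right)
  ultimately have "?S = hyperplane \<phi>" using B(4) by blast
  moreover have "dotp \<theta> (q l) = t ^ l" for l
    using v by (simp add: q_def dotp_add_right dotp_scale_right vector_sub_rdistrib dotp_diff_right)
  ultimately show thesis by (rule that)
qed

text \<open>Applied to the differences of distinct symbol vectors; this is where the finiteness of
  the alphabet enters the choice of the precoders.\<close>

lemma finite_polynomials_common_nonroot:
  fixes D :: "(nat \<Rightarrow> complex) set"
  assumes "finite D" "\<And>x. x \<in> D \<Longrightarrow> \<exists>l<n. x l \<noteq> 0"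
  obtains t where "t \<noteq> 0" "\<And>x. x \<in> D \<Longrightarrow> (\<Sum>l<n. x l * t ^ l) \<noteq> 0"
proof -
  define p where "p x = (\<Sum>l<n. monom (x l) l)" for x :: "nat \<Rightarrow> complex"
  have "p x \<noteq> 0" if x: "x \<in> D" for x
  proof -
    obtain l where l: "l < n" "x l \<noteq> 0" using assms(2)[OF x] by blast
    have "coeff (p x) l = x l"
      using l(1) by (simp add: p_def coeff_sum if_distrib cong: if_cong)
    with l(2) show ?thesis by auto
  qed
  then have "finite ({0} \<union> (\<Union>x\<in>D. {t. poly (p x) t = 0}))"
    using assms(1) by (auto intro: poly_roots_finite)
  then obtain t where t: "t \<notin> {0} \<union> (\<Union>x\<in>D. {t. poly (p x) t = 0})"
    using ex_new_if_finite[OF infinite_UNIV_char_0] by blast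
  show thesis
    by (rule that[of t]) (use t in \<open>auto simp: p_def poly_sum poly_monom\<close>)
qed

subsection \<open>The covariance of interference plus noise\<close>

definition cinner :: "complex ^ 'n \<Rightarrow> complex ^ 'n::finite \<Rightarrow> complex" where
  "cinner u w = (\<Sum>a\<in>UNIV. cnj (u $ a) * w $ a)"

lemma cinner_add_right: "cinner u (v + w) = cinner u v + cinner u w"
  and cinner_diff_right: "cinner u (v - w) = cinner u v - cinner u w"
  and cinner_scale_right: "cinner u (c *s w) = c * cinner u w"
  by (simp_all add: cinner_def algebra_simps sum.distrib sum_subtractf sum_distrib_left)

lemma cinner_zero_right [simp]: "cinner u 0 = 0"
  by (simp add: cinner_def)

lemma cinner_sum_right: "cinner u (\<Sum>k\<in>K. f k) = (\<Sum>k\<in>K. cinner u (f k))"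
  by (induction K rule: infinite_finite_induct) (simp_all add: cinner_add_right)

lemma cinner_commute: "cinner w v = cnj (cinner v w)"
  by (simp add: cinner_def mult.commute)

lemma norm_vec_power2: "(norm (v :: complex ^ 'n::finite))\<^sup>2 = (\<Sum>a\<in>UNIV. (cmod (v $ a))\<^sup>2)"
  by (simp add: norm_vec_def L2_set_def sum_nonneg)

lemma cinner_self: "cinner v v = of_real ((norm v)\<^sup>2)"
  unfolding cinner_def norm_vec_power2 of_real_sum
  by (intro sum.cong) (simp_all only: complex_norm_square mult.commute)

lemma norm_dotp_le: "cmod (dotp u v) \<le> norm u * norm v"
proof -
  have "cmod (dotp u v) \<le> (\<Sum>a\<in>UNIV. \<bar>cmod (u $ a)\<bar> * \<bar>cmod (v $ a)\<bar>)"
    unfolding dotp_def by (rule order_trans[OF norm_sum]) (simp add: norm_mult)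
  also have "\<dots> \<le> norm u * norm v"
    unfolding norm_vec_def by (rule L2_set_mult_ineq)
  finally show ?thesis .
qed

lemma norm_smult_vec: "norm (c *s (v :: complex ^ 'n::finite)) = cmod c * norm v"
  by (rule power2_eq_imp_eq)
     (simp_all add: norm_vec_power2 power_mult_distrib norm_mult sum_distrib_left)

text \<open>The matrix \<open>s I + A A\<^sup>H\<close>, with the columns of all interferers
  collected in one family indexed by \<open>K\<close>.\<close>

definition noise_cov :: "'k set \<Rightarrow> ('k \<Rightarrow> complex ^ 'n) \<Rightarrow> real \<Rightarrow> complex ^ 'n ^ 'n::finite" where
  "noise_cov K A s = mat (complex_of_real s) + (\<chi> a b. \<Sum>k\<in>K. A k $ a * cnj (A k $ b))"

lemma noise_cov_mult:
  "noise_cov K A s *v v = complex_of_real s *s v + (\<Sum>k\<in>K. cinner (A k) v *s A k)"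
proof -
  have "mat c *v v = c *s v" for c
    by (simp add: vec_eq_iff matrix_vector_mult_def mat_def if_distrib if_distribR cong: if_cong)
  moreover have "(\<chi> a b. \<Sum>k\<in>K. A k $ a * cnj (A k $ b)) *v v = (\<Sum>k\<in>K. cinner (A k) v *s A k)"
    unfolding vec_eq_iff
  proof
    fix a
    have "((\<chi> a b. \<Sum>k\<in>K. A k $ a * cnj (A k $ b)) *v v) $ a
       = (\<Sum>b\<in>UNIV. \<Sum>k\<in>K. A k $ a * cnj (A k $ b) * v $ b)"
      by (simp add: matrix_vector_mult_def sum_distrib_right)
    also have "\<dots> = (\<Sum>k\<in>K. \<Sum>b\<in>UNIV. A k $ a * cnj (A k $ b) * v $ b)" by (rule sum.swap)
    also have "\<dots> = (\<Sum>k\<in>K. cinner (A k) v *s A k) $ a"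
      by (simp add: cinner_def sum_distrib_left sum_distrib_right mult_ac)
    finally show "((\<chi> a b. \<Sum>k\<in>K. A k $ a * cnj (A k $ b)) *v v) $ a = (\<Sum>k\<in>K. cinner (A k) v *s A k) $ a" .
  qed
  ultimately show ?thesis by (simp add: noise_cov_def matrix_vector_mult_add_rdistrib)
qed

lemma cinner_noise_cov:
  "cinner v (noise_cov K A s *v v) = of_real (s * (norm v)\<^sup>2 + (\<Sum>k\<in>K. (cmod (cinner (A k) v))\<^sup>2))"
proof -
  have "cinner (A k) v * cinner v (A k) = of_real ((cmod (cinner (A k) v))\<^sup>2)" for k
    unfolding cinner_commute[of v "A k"] by (rule complex_norm_square[symmetric])
  then show ?thesis
    by (simp add: noise_cov_mult cinner_add_right cinner_sum_right cinner_scale_right cinner_self)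
qed

lemma det_noise_cov_nonzero:
  assumes "s > 0"
  shows "det (noise_cov K A s) \<noteq> 0"
proof -
  have "v = 0" if "noise_cov K A s *v v = 0" for v
  proof -
    have "s * (norm v)\<^sup>2 + (\<Sum>k\<in>K. (cmod (cinner (A k) v))\<^sup>2) = 0"
      using cinner_noise_cov[of v K A s] unfolding that
      by (metis cinner_zero_right of_real_eq_0_iff)
    moreover have "(\<Sum>k\<in>K. (cmod (cinner (A k) v))\<^sup>2) \<ge> 0" by (intro sum_nonneg) simp
    ultimately have "s * (norm v)\<^sup>2 \<le> 0" by linarith
    then show "v = 0" using assms by (simp add: mult_le_0_iff)
  qed
  then show ?thesis
    using matrix_left_invertible_ker[of "noise_cov K A s"] invertible_det_nz invertible_left_inverse by blast
qed

text \<open>The matrix is Hermitian, so conjugation amounts to transposition. This lets the real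
  part in the Gaussian density be compared with the modulus of the determinant.\<close>

lemma det_noise_cov_real: "det (noise_cov K A s) \<in> \<real>"
proof -
  let ?R = "noise_cov K A s"
  have "cnj (det ?R) = det (\<chi> a b. cnj (?R $ a $ b))"
    by (simp add: det_def)
  also have "(\<chi> a b. cnj (?R $ a $ b)) = transpose ?R"
    by (auto simp: vec_eq_iff transpose_def noise_cov_def mat_def mult.commute intro!: sum.cong)
  finally show ?thesis by (simp add: det_transpose Reals_cnj_iff)
qed

lemma noise_cov_inv_mult:
  assumes "s > 0"
  shows "noise_cov K A s *v (matrix_inv (noise_cov K A s) *v w) = w"
proof -
  have "invertible (noise_cov K A s)"
    using det_noise_cov_nonzero[OF assms] invertible_det_nz by blast
  then have "noise_cov K A s ** matrix_inv (noise_cov K A s) = mat 1"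
    unfolding invertible_def matrix_inv_def by (rule someI2_ex) simp
  then show ?thesis by (simp add: matrix_vector_mul_assoc)
qed

lemma hermitian_form_cinner: "hermitian_form A w = Re (cinner w (A *v w))"
  by (simp add: hermitian_form_def cinner_def)

text \<open>Substituting \<open>w = R v\<close> turns the form of the inverse into the form of
  \<open>R\<close> itself, which is an explicit sum of squares.\<close>

lemma hermitian_form_inv:
  fixes w :: "complex ^ 'n::finite" and K and A :: "'k \<Rightarrow> complex ^ 'n" and s :: real
  assumes "s > 0"
  defines "v \<equiv> matrix_inv (noise_cov K A s) *v w"
  shows "hermitian_form (matrix_inv (noise_cov K A s)) w = s * (norm v)\<^sup>2 + (\<Sum>k\<in>K. (cmod (cinner (A k) v))\<^sup>2)"
proof -
  have "cinner w v = cnj (cinner v (noise_cov K A s *v v))"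
    unfolding v_def noise_cov_inv_mult[OF assms(1)] by (rule cinner_commute)
  then show ?thesis by (simp add: hermitian_form_cinner cinner_noise_cov flip: v_def)
qed

lemma hermitian_form_inv_ge:
  assumes "s > 0"
  shows "s * (norm (matrix_inv (noise_cov K A s) *v w))\<^sup>2 \<le> hermitian_form (matrix_inv (noise_cov K A s)) w"
  unfolding hermitian_form_inv[OF assms] by (simp add: sum_nonneg)

text \<open>The form is a sum of squared norms of linear functions of its argument, and each square
  obeys this inequality. It replaces the triangle inequality in the detection metric.\<close>

lemma hermitian_form_inv_diff:
  fixes K and A :: "'k \<Rightarrow> complex ^ 'n::finite" and s :: real
  assumes "s > 0"
  defines "q \<equiv> hermitian_form (matrix_inv (noise_cov K A s))"
  shows "q (x - y) \<le> 2 * q x + 2 * q y"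
proof -
  define T where "T = (\<lambda>w. matrix_inv (noise_cov K A s) *v w)"
  have sq: "(norm (a - b))\<^sup>2 \<le> 2 * (norm a)\<^sup>2 + 2 * (norm b)\<^sup>2" for a b :: "'x::real_normed_vector"
  proof -
    have "(norm (a - b))\<^sup>2 \<le> (norm a + norm b)\<^sup>2"
      by (intro power_mono norm_triangle_ineq4) simp
    also have "\<dots> \<le> 2 * (norm a)\<^sup>2 + 2 * (norm b)\<^sup>2"
      using zero_le_power2[of "norm a - norm b"] by (simp add: power2_eq_square algebra_simps)
    finally show ?thesis .
  qed
  have q: "q w = s * (norm (T w))\<^sup>2 + (\<Sum>k\<in>K. (cmod (cinner (A k) (T w)))\<^sup>2)" for w
    unfolding q_def T_def by (rule hermitian_form_inv[OF assms(1)])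
  have T: "T (x - y) = T x - T y"
    by (simp add: T_def matrix_vector_mult_diff_distrib)
  have "s * (norm (T (x - y)))\<^sup>2 \<le> s * (2 * (norm (T x))\<^sup>2 + 2 * (norm (T y))\<^sup>2)"
    unfolding T using assms(1) by (intro mult_left_mono sq) simp
  moreover have "(\<Sum>k\<in>K. (cmod (cinner (A k) (T (x - y))))\<^sup>2) \<le>
      (\<Sum>k\<in>K. 2 * (cmod (cinner (A k) (T x)))\<^sup>2 + 2 * (cmod (cinner (A k) (T y)))\<^sup>2)"
    unfolding T cinner_diff_right by (intro sum_mono sq)
  ultimately show ?thesis
    unfolding q by (simp add: sum.distrib sum_distrib_left algebra_simps)
qed

text \<open>Since \<open>\<psi>\<close> annihilates every interference column, it sees the
  covariance as \<open>s\<close> times the identity. Vectors with a nonzero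
  \<open>\<psi>\<close>-value therefore have a metric length of order \<open>1 / s\<close>.\<close>

lemma hermitian_form_inv_null_direction:
  assumes "s > 0" "\<And>k. k \<in> K \<Longrightarrow> dotp \<psi> (A k) = 0"
  shows "(cmod (dotp \<psi> w))\<^sup>2 \<le> s * (norm \<psi>)\<^sup>2 * hermitian_form (matrix_inv (noise_cov K A s)) w"
proof -
  define v where "v = matrix_inv (noise_cov K A s) *v w"
  have "dotp \<psi> w = dotp \<psi> (noise_cov K A s *v v)"
    by (simp add: v_def noise_cov_inv_mult[OF assms(1)])
  also have "\<dots> = s * dotp \<psi> v"
    using assms(2) by (simp add: noise_cov_mult dotp_add_right dotp_sum_right dotp_scale_right)
  finally have "cmod (dotp \<psi> w) = s * cmod (dotp \<psi> v)"
    using assms(1) by (simp add: norm_mult)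
  also have "\<dots> \<le> s * (norm \<psi> * norm v)"
    using assms(1) norm_dotp_le by (intro mult_left_mono) auto
  finally have "(cmod (dotp \<psi> w))\<^sup>2 \<le> (s * (norm \<psi> * norm v))\<^sup>2" by (intro power_mono) auto
  also have "\<dots> = s * (norm \<psi>)\<^sup>2 * (s * (norm v)\<^sup>2)" by (simp add: power2_eq_square)
  also have "\<dots> \<le> s * (norm \<psi>)\<^sup>2 * hermitian_form (matrix_inv (noise_cov K A s)) w"
    using assms(1) hermitian_form_inv_ge[OF assms(1), of K A w]
    by (intro mult_left_mono) (auto simp: v_def)
  finally show ?thesis .
qed

text \<open>The constant does not depend on \<open>s\<close>, so a single integrable Gaussian
  dominates the exponentials for all small noise levels.\<close>

lemma hermitian_form_inv_coercive:
  assumes "0 < s" "s \<le> 1"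
  shows "(norm w)\<^sup>2 \<le> 2 * (1 + (\<Sum>k\<in>K. (norm (A k))\<^sup>2)) * hermitian_form (matrix_inv (noise_cov K A s)) w"
proof -
  define v where "v = matrix_inv (noise_cov K A s) *v w"
  define a b where "a = s * norm v" and "b = (\<Sum>k\<in>K. cmod (cinner (A k) v) * norm (A k))"
  define S C where "S = (\<Sum>k\<in>K. (norm (A k))\<^sup>2)" and "C = (\<Sum>k\<in>K. (cmod (cinner (A k) v))\<^sup>2)"
  have S: "S \<ge> 0" and C: "C \<ge> 0" by (auto simp: S_def C_def intro: sum_nonneg)
  have q: "hermitian_form (matrix_inv (noise_cov K A s)) w = s * (norm v)\<^sup>2 + C"
    unfolding v_def C_def by (rule hermitian_form_inv[OF assms(1)])
  have "norm w = norm (noise_cov K A s *v v)"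
    by (simp add: v_def noise_cov_inv_mult[OF assms(1)])
  also have "\<dots> \<le> a + b"
    unfolding noise_cov_mult a_def b_def using assms(1)
    by (intro order_trans[OF norm_triangle_ineq] add_mono order_trans[OF norm_sum])
       (simp_all add: norm_smult_vec)
  finally have "(norm w)\<^sup>2 \<le> (a + b)\<^sup>2" by (intro power_mono) auto
  also have "\<dots> \<le> 2 * a\<^sup>2 + 2 * b\<^sup>2"
    using zero_le_power2[of "a - b"] by (simp add: power2_eq_square algebra_simps)
  also have "b\<^sup>2 \<le> C * S"
    unfolding b_def C_def S_def by (rule Cauchy_Schwarz_ineq_sum)
  \<comment> \<open>Here \<open>s \<le> 1\<close> is used.\<close>
  also have "a\<^sup>2 \<le> s * (norm v)\<^sup>2"
    using assms mult_right_mono[of s 1 "s * (norm v)\<^sup>2"]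
    by (simp add: a_def power2_eq_square mult_ac)
  finally have "(norm w)\<^sup>2 \<le> 2 * (s * (norm v)\<^sup>2) + 2 * (C * S)" by simp
  also have "\<dots> \<le> 2 * (1 + S) * (s * (norm v)\<^sup>2 + C)"
  proof -
    have "0 \<le> S * (s * (norm v)\<^sup>2)" using S assms(1) by simp
    then show ?thesis using C by (simp add: algebra_simps)
  qed
  finally show ?thesis unfolding q S_def .
qed

section \<open>A lower bound for the determinant of the covariance\<close>

lemma norm_det_le:
  fixes A :: "complex ^ 'n ^ 'n::finite"
  assumes "\<And>a b. cmod (A $ a $ b) \<le> B"
  shows "cmod (det A) \<le> fact CARD('n) * B ^ CARD('n)"
proof -
  have "cmod (det A) \<le> (\<Sum>p\<in>{p. p permutes (UNIV::'n set)}. B ^ CARD('n))"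
    unfolding det_def
  proof (intro order_trans[OF norm_sum] sum_mono)
    fix p :: "'n \<Rightarrow> 'n"
    have "cmod (of_int (sign p) * (\<Prod>i\<in>UNIV. A $ i $ p i)) = (\<Prod>i\<in>UNIV. cmod (A $ i $ p i))"
      by (simp add: norm_mult sign_def prod_norm)
    also have "\<dots> \<le> (\<Prod>i\<in>(UNIV::'n set). B)"
      by (intro prod_mono) (auto intro: assms)
    finally show "cmod (of_int (sign p) * (\<Prod>i\<in>UNIV. A $ i $ p i)) \<le> B ^ CARD('n)" by simp
  qed
  then show ?thesis by (simp add: card_permutations)
qed

text \<open>The entries of the inverse are at most \<open>1 / s\<close> in modulus, so the Leibniz
  expansion bounds the determinant of the inverse from above; its reciprocal gives the
  claim.\<close>

lemma det_noise_cov_ge: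
  fixes A :: "'k \<Rightarrow> complex ^ 'n::finite"
  assumes "s > 0"
  shows "s ^ CARD('n) / fact CARD('n) \<le> \<bar>Re (det (noise_cov K A s))\<bar>"
proof -
  let ?R = "noise_cov K A s"
  have "cmod (matrix_inv ?R $ a $ c) \<le> 1 / s" for a c
  proof -
    define v where "v = matrix_inv ?R *v axis c 1"
    have "s * (norm v)\<^sup>2 \<le> hermitian_form (matrix_inv ?R) (axis c 1)"
      unfolding v_def by (rule hermitian_form_inv_ge[OF assms])
    also have "\<dots> = Re (v $ c)"
      by (simp add: hermitian_form_cinner v_def cinner_def axis_def if_distrib if_distribR cong: if_cong)
    also have "\<dots> \<le> norm v"
      using complex_Re_le_cmod[of "v $ c"] Finite_Cartesian_Product.norm_nth_le[of v c] by linarith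
    finally have "s * norm v \<le> 1" by (cases "norm v = 0") (auto simp: power2_eq_square)
    then have "norm v \<le> 1 / s" using assms by (simp add: field_simps)
    moreover have "matrix_inv ?R $ a $ c = v $ a"
      by (simp add: v_def matrix_vector_mult_def axis_def if_distrib if_distribR cong: if_cong)
    ultimately show ?thesis using Finite_Cartesian_Product.norm_nth_le[of v a] by simp
  qed
  from norm_det_le[OF this]
  have "cmod (det (matrix_inv ?R)) \<le> fact CARD('n) / s ^ CARD('n)" by (simp add: power_divide)
  moreover have "det ?R * det (matrix_inv ?R) = 1"
  proof -
    have "?R ** matrix_inv ?R = mat 1"
      by (simp add: matrix_eq noise_cov_inv_mult[OF assms] flip: matrix_vector_mul_assoc)
    then show ?thesis by (metis det_I det_mul)
  qed
  then have "cmod (det ?R) * cmod (det (matrix_inv ?R)) = 1" by (metis norm_mult norm_one)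
  ultimately have "1 \<le> cmod (det ?R) * (fact CARD('n) / s ^ CARD('n))"
    by (metis mult_left_mono norm_ge_zero)
  then have "s ^ CARD('n) / fact CARD('n) \<le> cmod (det ?R)"
    using assms by (simp add: field_simps)
  also have "\<dots> = \<bar>Re (det ?R)\<bar>"
    using det_noise_cov_real by (rule in_Reals_norm)
  finally show ?thesis .
qed

subsection \<open>Vanishing bit error rate\<close>

lemma nn_integral_exp_square_finite:
  assumes "c > 0"
  shows "(\<integral>\<^sup>+x. ennreal (exp (- c * x\<^sup>2)) \<partial>lborel) < \<infinity>"
proof -
  \<comment> \<open>The standard deviation for which \<open>normal_density\<close> has the exponent
    \<open>- c * x\<^sup>2\<close>.\<close>
  define \<sigma> where "\<sigma> = sqrt (1 / (2 * c))"
  have \<sigma>: "\<sigma> > 0" and \<sigma>2: "\<sigma>\<^sup>2 = 1 / (2 * c)"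
    using assms by (simp_all add: \<sigma>_def)
  have "exp (- c * x\<^sup>2) = sqrt (2 * pi * \<sigma>\<^sup>2) * normal_density 0 \<sigma> x" for x
    using \<sigma> assms by (simp add: normal_density_def \<sigma>2 field_simps)
  moreover have "integrable lborel (\<lambda>x. sqrt (2 * pi * \<sigma>\<^sup>2) * normal_density 0 \<sigma> x)"
    using \<sigma> by (intro integrable_mult_right integrable_normal_density)
  ultimately have "integrable lborel (\<lambda>x. exp (- c * x\<^sup>2))" by simp
  then show ?thesis
    by (simp add: integrable_iff_bounded)
qed

lemma nn_integral_exp_norm_square_finite:
  fixes c :: real
  assumes "c > 0"
  shows "(\<integral>\<^sup>+w. ennreal (exp (- c * (norm w)\<^sup>2)) \<partial>(lborel :: 'a::euclidean_space measure)) < \<infinity>"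
proof -
  have "ennreal (exp (- c * (norm w)\<^sup>2)) = (\<Prod>b\<in>Basis. ennreal (exp (- c * (w \<bullet> b)\<^sup>2)))" for w :: 'a
  proof -
    have "(norm w)\<^sup>2 = (\<Sum>b\<in>Basis. (w \<bullet> b)\<^sup>2)"
      unfolding power2_norm_eq_inner by (subst euclidean_inner) (simp add: power2_eq_square)
    then have "exp (- c * (norm w)\<^sup>2) = (\<Prod>b\<in>Basis. exp (- c * (w \<bullet> b)\<^sup>2))"
      by (simp add: sum_distrib_left exp_sum flip: sum_negf)
    then show ?thesis by (simp add: prod_ennreal)
  qed
  then have "(\<integral>\<^sup>+w. ennreal (exp (- c * (norm w)\<^sup>2)) \<partial>(lborel :: 'a measure))
      = (\<Prod>b\<in>(Basis :: 'a set). (\<integral>\<^sup>+x. ennreal (exp (- c * x\<^sup>2)) \<partial>lborel))"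
    by (simp only:) (rule nn_integral_lborel_prod, auto)
  also have "\<dots> < \<infinity>"
    using nn_integral_exp_square_finite[OF assms] by (simp add: power_less_top_ennreal)
  finally show ?thesis .
qed

lemma continuous_on_hermitian_form: "continuous_on UNIV (hermitian_form A)"
  unfolding hermitian_form_def matrix_vector_mult_def vec_lambda_beta
  by (intro continuous_intros)

lemma hermitian_form_measurable [measurable]: "hermitian_form A \<in> borel_measurable borel"
  by (rule borel_measurable_continuous_onI[OF continuous_on_hermitian_form])

text \<open>
  The crude bound \<open>s\<^sup>-\<^sup>M\<close> on the normalising constant suffices because the tail is exponentially
  small in \<open>1 / s\<close>.
\<close>

lemma complex_gaussian_tail:
  fixes A :: "'k \<Rightarrow> complex ^ 'n::finite"
  obtains C where "C \<ge> 0" "\<And>s r. 0 < s \<Longrightarrow> s \<le> 1 \<Longrightarrow>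
    emeasure (complex_gaussian (noise_cov K A s))
      {w. r \<le> hermitian_form (matrix_inv (noise_cov K A s)) w} \<le> ennreal (exp (- r / 2) * C / s ^ CARD('n))"
proof -
  define L where "L = 2 * (1 + (\<Sum>k\<in>K. (norm (A k))\<^sup>2))"
  have L: "L > 0" by (auto simp: L_def intro!: add_pos_nonneg sum_nonneg)
  define I where "I = (\<integral>\<^sup>+w. ennreal (exp (- (1 / (2 * L)) * (norm w)\<^sup>2)) \<partial>(lborel :: (complex ^ 'n) measure))"
  have "I < \<infinity>"
    unfolding I_def using L by (intro nn_integral_exp_norm_square_finite) simp
  then have I: "I = ennreal (enn2real I)" by (simp add: less_top)
  define F where "F = fact CARD('n) / pi ^ CARD('n)"
  have F: "F \<ge> 0" by (simp add: F_def)
  show thesis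
  proof (rule that[of "F * enn2real I"])
    show "F * enn2real I \<ge> 0" using F by simp
  next
    fix s r :: real
    assume s: "0 < s" "s \<le> 1"
    define R where "R = noise_cov K A s"
    define q where "q = hermitian_form (matrix_inv R)"
    define c where "c = exp (- r / 2) * (F / s ^ CARD('n))"
    have [measurable]: "q \<in> borel_measurable borel" by (simp add: q_def)
    have c: "c \<ge> 0" using F s by (simp add: c_def)
    have bound: "exp (- q w) / (pi ^ CARD('n) * Re (det R)) \<le> c * exp (- (1 / (2 * L)) * (norm w)\<^sup>2)"
      if "r \<le> q w" for w
    proof -
      have "(norm w)\<^sup>2 \<le> L * q w"
        unfolding L_def q_def R_def by (rule hermitian_form_inv_coercive[OF s])
      then have "1 / (2 * L) * (norm w)\<^sup>2 \<le> q w / 2"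
        using L by (simp add: field_simps)
      \<comment> \<open>Half of \<open>q w\<close> supplies the tail factor, the other half the
        integrability in \<open>w\<close>.\<close>
      then have "- q w \<le> - r / 2 + - (1 / (2 * L)) * (norm w)\<^sup>2" using that by simp
      then have 1: "exp (- q w) \<le> exp (- r / 2) * exp (- (1 / (2 * L)) * (norm w)\<^sup>2)"
        by (simp flip: exp_add)
      have det: "s ^ CARD('n) / fact CARD('n) \<le> \<bar>Re (det R)\<bar>"
        unfolding R_def by (rule det_noise_cov_ge[OF s(1)])
      \<comment> \<open>If the real part is not positive, the left side is at most 0 and the right
        side is nonnegative.\<close>
      have "exp (- q w) / (pi ^ CARD('n) * Re (det R)) \<le> exp (- q w) / (pi ^ CARD('n) * \<bar>Re (det R)\<bar>)"
        by (cases "Re (det R) > 0") (auto intro!: order_trans[OF divide_nonneg_nonpos] mult_nonneg_nonpos)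
      also have "\<dots> \<le> exp (- q w) / (pi ^ CARD('n) * (s ^ CARD('n) / fact CARD('n)))"
      proof (intro divide_left_mono mult_left_mono det)
        have "0 < s ^ CARD('n) / fact CARD('n)" using s by simp
        also note det
        finally show "0 < pi ^ CARD('n) * \<bar>Re (det R)\<bar> * (pi ^ CARD('n) * (s ^ CARD('n) / fact CARD('n)))"
          using s by simp
      qed auto
      also have "\<dots> = exp (- q w) * (F / s ^ CARD('n))" by (simp add: F_def field_simps)
      also have "\<dots> \<le> exp (- r / 2) * exp (- (1 / (2 * L)) * (norm w)\<^sup>2) * (F / s ^ CARD('n))"
        using 1 F s by (intro mult_right_mono) auto
      finally show ?thesis by (simp add: c_def mult_ac)
    qed
    have "emeasure (complex_gaussian R) {w. r \<le> q w} =
        (\<integral>\<^sup>+w. ennreal (exp (- q w) / (pi ^ CARD('n) * Re (det R))) * indicator {w. r \<le> q w} w \<partial>lborel)"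
      unfolding complex_gaussian_def q_def[symmetric] by (intro emeasure_density) auto
    also have "\<dots> \<le> (\<integral>\<^sup>+w. ennreal c * ennreal (exp (- (1 / (2 * L)) * (norm w)\<^sup>2)) \<partial>(lborel :: (complex ^ 'n) measure))"
      by (intro nn_integral_mono)
        (use bound c in \<open>auto simp: indicator_def simp flip: ennreal_mult'' intro!: ennreal_leI\<close>)
    also have "\<dots> = ennreal c * I"
      unfolding I_def by (rule nn_integral_cmult) simp
    also have "\<dots> = ennreal (exp (- r / 2) * (F * enn2real I) / s ^ CARD('n))"
      by (subst I, subst ennreal_mult[symmetric]) (use c in \<open>auto simp: c_def mult.assoc\<close>)
    finally show "emeasure (complex_gaussian (noise_cov K A s))
      {w. r \<le> hermitian_form (matrix_inv (noise_cov K A s)) w} \<le> ennreal (exp (- r / 2) * (F * enn2real I) / s ^ CARD('n))"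
      by (simp add: R_def q_def)
  qed
qed

text \<open>The substitution \<open>x = \<delta> / s\<close> reduces it to
  \<open>x ^ n / exp x\<close> at infinity.\<close>

lemma exp_inverse_over_power_tendsto_0:
  fixes \<delta> C :: real
  assumes "\<delta> > 0"
  shows "((\<lambda>s. exp (- (\<delta> / s)) * C / s ^ n) \<longlongrightarrow> 0) (at_right 0)"
proof -
  have "filterlim (\<lambda>s. \<delta> / s) at_top (at_right 0)"
    using assms by real_asymp
  then have "((\<lambda>s. (C / \<delta> ^ n) * ((\<delta> / s) ^ n / exp (\<delta> / s))) \<longlongrightarrow> (C / \<delta> ^ n) * 0) (at_right 0)"
    by (intro tendsto_mult tendsto_const filterlim_compose[OF tendsto_power_div_exp_0])
  then show ?thesis
    using assms by (simp add: exp_minus field_simps power_divide)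
qed

section \<open>Error events of the minimum distance detector\<close>

lemma interference_noise_cov_eq:
  "interference_noise_cov H n Q s i =
     noise_cov (SIGMA j:UNIV - {i}. {..<n j}) (\<lambda>(j, l). received H Q i j l) s"
  by (simp add: interference_noise_cov_def noise_cov_def columns_gram_def vec_eq_iff sum.Sigma
      case_prod_unfold)

lemma columns_mult_diff: "columns_mult n A x - columns_mult n A y = columns_mult n A (\<lambda>l. x l - y l)"
  by (simp add: columns_mult_def vector_sub_rdistrib sum_subtractf)

text \<open>A wrong decision requires noise whose metric length is comparable to the distance of two
  signal points. By the null direction \<open>\<psi>\<close> that distance is at least of order
  \<open>1 / s\<close>, and the Gaussian tail beyond it vanishes.\<close>

lemma BER_tendsto_0:
  fixes H :: "'m::finite channel"
  assumes X: "finite X" "X \<noteq> {}"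
    and orth: "\<And>j l. j \<noteq> i \<Longrightarrow> l < n j \<Longrightarrow> dotp \<psi> (received H Q i j l) = 0"
    and sep: "\<And>x y. x \<in> X \<Longrightarrow> y \<in> X \<Longrightarrow> x \<noteq> y \<Longrightarrow>
      dotp \<psi> (columns_mult (n i) (received H Q i i) (\<lambda>l. x l - y l)) \<noteq> 0"
  shows "((\<lambda>s. BER H n Q s i X b lab) \<longlongrightarrow> 0) (at_right 0)"
proof -
  define K where "K = (SIGMA j:UNIV - {i}. {..<n j})"
  define A where "A = (\<lambda>(j, l). received H Q i j l)"
  define T where "T = columns_mult (n i) (received H Q i i)"
  define q where "q = (\<lambda>s. hermitian_form (matrix_inv (noise_cov K A s)))"
  have cov: "interference_noise_cov H n Q s i = noise_cov K A s" for s
    unfolding K_def A_def by (rule interference_noise_cov_eq)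
  obtain C where C0: "C \<ge> 0" and C: "\<And>s r. 0 < s \<Longrightarrow> s \<le> 1 \<Longrightarrow>
    emeasure (complex_gaussian (noise_cov K A s)) {w. r \<le> q s w} \<le> ennreal (exp (- r / 2) * C / s ^ CARD('m))"
    unfolding q_def using complex_gaussian_tail[of K A] by blast
  define D where "D = {T x - T y | x y. x \<in> X \<and> y \<in> X \<and> x \<noteq> y}"
  \<comment> \<open>The added 1 keeps \<open>N\<close> positive.\<close>
  define N where "N = (norm \<psi>)\<^sup>2 + 1"
  have N: "N > 0" by (simp add: N_def add_nonneg_pos)
  have "finite ((\<lambda>(x, y). T x - T y) ` (X \<times> X))" using X(1) by simp
  then have "finite D" by (rule rev_finite_subset) (auto simp: D_def)
  have "\<exists>\<delta>>0. \<forall>d\<in>D. \<delta> \<le> (cmod (dotp \<psi> d))\<^sup>2"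
  proof (cases "D = {}")
    case True
    then show ?thesis by (auto intro: exI[of _ 1])
  next
    case False
    let ?S = "(\<lambda>d. (cmod (dotp \<psi> d))\<^sup>2) ` D"
    have "Min ?S \<in> ?S" using False \<open>finite D\<close> by (intro Min_in) auto
    moreover have "\<forall>z\<in>?S. z > 0" using sep by (auto simp: D_def T_def columns_mult_diff)
    ultimately have "Min ?S > 0" by blast
    then show ?thesis using \<open>finite D\<close> by (intro exI[of _ "Min ?S"]) auto
  qed
  then obtain \<delta> where \<delta>: "\<delta> > 0" "\<And>d. d \<in> D \<Longrightarrow> \<delta> \<le> (cmod (dotp \<psi> d))\<^sup>2" by blast
  \<comment> \<open>The 8 combines the 4 lost in comparing the noise with the distance and the 2 in
    the tail exponent \<open>r / 2\<close>.\<close>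
  define g where "g = (\<lambda>s. exp (- (\<delta> / (8 * N) / s)) * C / s ^ CARD('m))"
  have q_ge: "\<delta> / (N * s) \<le> q s d" if "s > 0" "d \<in> D" for s d
  proof -
    have "\<delta> \<le> s * (norm \<psi>)\<^sup>2 * q s d"
      using \<delta>(2)[OF that(2)] hermitian_form_inv_null_direction[OF that(1), of K \<psi> A d] orth
      by (auto simp: q_def K_def A_def split: prod.splits intro: order_trans)
    also have "\<dots> \<le> s * N * q s d"
    proof -
      have "0 \<le> q s d"
        using hermitian_form_inv_ge[OF that(1), of K A d] that(1)
        by (auto simp: q_def intro: order_trans[rotated])
      then show ?thesis using that(1) by (intro mult_right_mono mult_left_mono) (auto simp: N_def)
    qed
    finally show ?thesis using N that(1) by (simp add: field_simps)
  qed
  have err: "measure (complex_gaussian (noise_cov K A s))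
      {w. lab (MD_detector H n Q s i X (T x + w)) ! k \<noteq> lab x ! k} \<le> g s"
    if s: "0 < s" "s \<le> 1" and x: "x \<in> X" for s x k
  proof -
    let ?r = "\<delta> / (4 * N * s)"
    \<comment> \<open>A wrong bit implies a wrong symbol vector, so the same tail event covers every
      bit position \<open>k\<close>.\<close>
    have "{w. lab (MD_detector H n Q s i X (T x + w)) ! k \<noteq> lab x ! k} \<subseteq> {w. ?r \<le> q s w}"
    proof (rule subsetI, unfold mem_Collect_eq)
      fix w
      assume ne: "lab (MD_detector H n Q s i X (T x + w)) ! k \<noteq> lab x ! k"
      define y where "y = MD_detector H n Q s i X (T x + w)"
      let ?f = "\<lambda>z. q s (T x + w - T z)"
      have y: "y = arg_min_on ?f X"
        by (simp add: y_def MD_detector_def cov q_def T_def)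
      have "y \<in> X" unfolding y using X by (rule arg_min_if_finite)
      moreover have "?f y \<le> ?f x"
        unfolding y by (rule arg_min_least[OF X x])
      moreover have "x \<noteq> y" using ne by (auto simp: y_def)
      ultimately have "T x - T y \<in> D" "q s (T x - T y + w) \<le> q s w"
        using x unfolding D_def by (blast, simp add: algebra_simps)
      then have "\<delta> / (N * s) \<le> q s ((T x - T y + w) - w)" using q_ge s by simp
      also have "\<dots> \<le> 2 * q s (T x - T y + w) + 2 * q s w"
        unfolding q_def using s(1) by (rule hermitian_form_inv_diff)
      also have "\<dots> \<le> 4 * q s w" using \<open>q s (T x - T y + w) \<le> q s w\<close> by simp
      finally show "?r \<le> q s w" by simp
    qed
    moreover have "{w. ?r \<le> q s w} \<in> sets (complex_gaussian (noise_cov K A s))"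
      unfolding complex_gaussian_def q_def by simp
    ultimately have "emeasure (complex_gaussian (noise_cov K A s))
        {w. lab (MD_detector H n Q s i X (T x + w)) ! k \<noteq> lab x ! k}
       \<le> emeasure (complex_gaussian (noise_cov K A s)) {w. ?r \<le> q s w}"
      by (rule emeasure_mono)
    also have "\<dots> \<le> ennreal (exp (- ?r / 2) * C / s ^ CARD('m))" using s by (rule C)
    also have "exp (- ?r / 2) * C / s ^ CARD('m) = g s" by (simp add: g_def mult_ac)
    finally have le: "emeasure (complex_gaussian (noise_cov K A s))
        {w. lab (MD_detector H n Q s i X (T x + w)) ! k \<noteq> lab x ! k} \<le> ennreal (g s)" .
    moreover have "g s \<ge> 0" using C0 s by (simp add: g_def)
    ultimately show ?thesis unfolding measure_def by (intro enn2real_leI)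
  qed
  have lim: "(g \<longlongrightarrow> 0) (at_right 0)"
    unfolding g_def using \<delta>(1) N by (intro exp_inverse_over_power_tendsto_0) simp
  have "((\<lambda>s. measure (complex_gaussian (noise_cov K A s))
      {w. lab (MD_detector H n Q s i X (T x + w)) ! k \<noteq> lab x ! k}) \<longlongrightarrow> 0) (at_right 0)"
    if "x \<in> X" for x k
  proof (rule tendsto_sandwich[OF _ _ tendsto_const lim])
    show "\<forall>\<^sub>F s in at_right 0. measure (complex_gaussian (noise_cov K A s))
      {w. lab (MD_detector H n Q s i X (T x + w)) ! k \<noteq> lab x ! k} \<le> g s"
      unfolding eventually_at_right_field using err that by (intro exI[of _ 1]) auto
  qed simp
  then have "((\<lambda>s. \<Sum>x\<in>X. \<Sum>k<b. measure (complex_gaussian (noise_cov K A s))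
      {w. lab (MD_detector H n Q s i X (T x + w)) ! k \<noteq> lab x ! k}) \<longlongrightarrow> (\<Sum>x\<in>X. \<Sum>k<b. 0)) (at_right 0)"
    by (intro tendsto_sum) auto
  from tendsto_mult_right[OF this, of "inverse (real (card X) * real b)"]
  show ?thesis by (simp add: BER_def cov divide_inverse flip: T_def)
qed

subsection \<open>Streams of achievable tuples\<close>

text \<open>An invertible channel preserves the dimension of the precoder's column space, and its
  image lies in an interference space that must be proper.\<close>

lemma full_rank_interferer_streams_less:
  fixes H :: "'m::finite channel"
  assumes "FIA H n Q i" "det (H i j) \<noteq> 0" "i \<noteq> j" "full_column_rank (n j) (Q j)"
  shows "n j < CARD('m)"
proof -
  have inj: "inj ((*v) (H i j))"
    using assms(2) by (metis inj_matrix_vector_mult invertible_det_nz)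
  have "n j = vec.dim (column_space (n j) (Q j))"
    using assms(4) by (simp add: full_column_rank_def)
  also have "\<dots> = vec.dim ((*v) (H i j) ` column_space (n j) (Q j))"
    using inj by (intro vec.dim_image_eq[symmetric] matrix_vector_mul_linear_gen) (auto intro: inj_on_subset)
  also have "(*v) (H i j) ` column_space (n j) (Q j) = column_space (n j) (received H Q i j)"
    unfolding column_space_def vec.linear_span_image[OF matrix_vector_mul_linear_gen, symmetric]
    by (simp add: received_def image_image)
  also have "vec.dim \<dots> \<le> vec.dim (interference_space H n Q i)"
    unfolding column_space_def interference_space_def
    using assms(3) by (intro vec.dim_subset vec.span_mono) auto
  also have "\<dots> < CARD('m)" using assms(1) by (simp add: FIA_def)
  finally show ?thesis .
qed

text \<open>Precoder \<open>i\<close> is a Vandermonde basis of the kernel of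
  \<open>\<phi> i\<close> with respect to the functional \<open>\<psi> i v* H i i\<close>. Its
  parameter \<open>t i\<close> avoids the roots of all difference polynomials of the alphabet
  \<open>X i\<close>.\<close>

lemma aligned_precoders:
  fixes H :: "'m::finite channel"
  assumes M: "CARD('m) \<ge> 2" and "generic H"
    and X: "\<And>i. finite (X i)" "\<And>i. X i \<subseteq> extensional {..<CARD('m) - 1}"
  obtains Q \<psi> where "\<And>j. full_column_rank (CARD('m) - 1) (Q j)"
    "\<And>i. FIA H (\<lambda>_. CARD('m) - 1) Q i"
    "\<And>i j l. j \<noteq> i \<Longrightarrow> l < CARD('m) - 1 \<Longrightarrow> dotp (\<psi> i) (received H Q i j l) = 0"
    "\<And>i x y. x \<in> X i \<Longrightarrow> y \<in> X i \<Longrightarrow> x \<noteq> y \<Longrightarrow>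
      dotp (\<psi> i) (columns_mult (CARD('m) - 1) (received H Q i i) (\<lambda>l. x l - y l)) \<noteq> 0"
proof -
  let ?n = "CARD('m) - 1"
  have nz: "det (H i j) \<noteq> 0" for i j using \<open>generic H\<close> by (simp add: generic_def)
  obtain \<phi> \<psi> :: "3 \<Rightarrow> complex ^ 'm" where \<phi>: "\<And>i. \<phi> i \<noteq> 0"
    and cross: "\<And>i j. i \<noteq> j \<Longrightarrow> \<exists>c. \<psi> i v* H i j = c *s \<phi> j"
    and direct: "\<And>i c. \<psi> i v* H i i \<noteq> c *s \<phi> i"
    using alignment[OF \<open>generic H\<close>] by blast
  have \<psi>: "\<psi> i \<noteq> 0" for i using direct[of i 0] by auto
  have "\<exists>t. t \<noteq> 0 \<and> (\<forall>x\<in>X i. \<forall>y\<in>X i. x \<noteq> y \<longrightarrow> (\<Sum>l<?n. (x l - y l) * t ^ l) \<noteq> 0)" for i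
  proof -
    let ?D = "{\<lambda>l. x l - y l | x y. x \<in> X i \<and> y \<in> X i \<and> x \<noteq> y}"
    have "finite ((\<lambda>(x, y) l. x l - y l) ` (X i \<times> X i))" using X(1) by simp
    then have "finite ?D" by (rule rev_finite_subset) auto
    moreover have "\<exists>l<?n. z l \<noteq> 0" if z: "z \<in> ?D" for z
    proof (rule ccontr)
      obtain x y where xy: "x \<in> X i" "y \<in> X i" "x \<noteq> y" "z = (\<lambda>l. x l - y l)" using z by blast
      assume "\<not> (\<exists>l<?n. z l \<noteq> 0)"
      then have "x l = y l" if "l \<in> {..<?n}" for l using that xy(4) by auto
      \<comment> \<open>Extensional functions agree outside \<open>{..<?n}\<close>, so distinct
        symbol vectors differ in one of the first \<open>?n\<close> entries.\<close>
      with xy X(2) have "x = y" by (intro extensionalityI[of x "{..<?n}" y]) auto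
      with xy(3) show False by simp
    qed
    ultimately obtain t where "t \<noteq> 0" "\<And>z. z \<in> ?D \<Longrightarrow> (\<Sum>l<?n. z l * t ^ l) \<noteq> 0"
      using finite_polynomials_common_nonroot[of ?D ?n] by blast
    then show ?thesis by (intro exI[of _ t]) blast
  qed
  then obtain t where t: "\<And>i. t i \<noteq> 0"
    "\<And>i x y. x \<in> X i \<Longrightarrow> y \<in> X i \<Longrightarrow> x \<noteq> y \<Longrightarrow> (\<Sum>l<?n. (x l - y l) * t i ^ l) \<noteq> 0"
    by metis
  have "\<exists>q. vec.span (q ` {..<?n}) = hyperplane (\<phi> i) \<and>
      (\<forall>l<?n. dotp (\<psi> i v* H i i) (q l) = t i ^ l)" for i
    using hyperplane_vandermonde_basis[OF \<phi> direct t(1), of i] by blast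
  then obtain Q where span: "\<And>i. vec.span (Q i ` {..<?n}) = hyperplane (\<phi> i)"
    and vdm: "\<And>i l. l < ?n \<Longrightarrow> dotp (\<psi> i v* H i i) (Q i l) = t i ^ l"
    by metis
  have rank: "full_column_rank ?n (Q j)" for j
    unfolding full_column_rank_def column_space_def span using \<phi> by (rule dim_hyperplane_complex)
  have orth: "dotp (\<psi> i) (received H Q i j l) = 0" if ij: "j \<noteq> i" and l: "l < ?n" for i j l
  proof -
    obtain c where "\<psi> i v* H i j = c *s \<phi> j" using cross[OF ij[symmetric]] by blast
    moreover have "Q j l \<in> hyperplane (\<phi> j)"
      using l unfolding span[symmetric] by (intro vec.span_base) auto
    ultimately show ?thesis
      by (simp add: received_def dotp_scale_left flip: dotp_vector_matrix_mult)
  qed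
  have FIA: "FIA H (\<lambda>_. ?n) Q i" for i
  proof -
    let ?I = "interference_space H (\<lambda>_. ?n) Q i" and ?S = "signal_space H (\<lambda>_. ?n) Q i"
    have I_sub: "?I \<subseteq> hyperplane (\<psi> i)"
      unfolding interference_space_def using orth by (intro vec.span_minimal subspace_hyperplane) auto
    then have "vec.dim ?I \<le> ?n"
      using vec.dim_subset dim_hyperplane_complex[OF \<psi>] by metis
    obtain j where j: "j \<noteq> i" using exhaust_3[of i] by (metis zero_neq_one)
    have inj: "inj ((*v) (H i j))"
      using nz by (metis inj_matrix_vector_mult invertible_det_nz)
    have sub: "(*v) (H i j) ` hyperplane (\<phi> j) \<subseteq> ?I"
      unfolding interference_space_def span[symmetric] vec.linear_span_image[OF matrix_vector_mul_linear_gen, symmetric]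
      using j by (intro vec.span_mono) (auto simp: received_def image_image)
    have "vec.dim ((*v) (H i j) ` hyperplane (\<phi> j)) = ?n"
      using inj dim_hyperplane_complex[OF \<phi>[of j]]
      by (subst vec.dim_image_eq[OF matrix_vector_mul_linear_gen]) (auto intro: inj_on_subset)
    then have "?n \<le> vec.dim ?I" using vec.dim_subset[OF sub] by simp
    \<comment> \<open>A single interferer already contributes \<open>?n\<close> dimensions, which is
      the full dimension of the kernel of \<open>\<psi> i\<close>.\<close>
    then have I: "?I = hyperplane (\<psi> i)"
      using I_sub dim_hyperplane_complex[OF \<psi>[of i]]
      by (intro vec.subspace_dim_equal subspace_hyperplane) (auto simp: interference_space_def vec.subspace_span)
    have "0 < ?n" using M by simp
    \<comment> \<open>Column 0 has the \<open>\<psi> i\<close>-value \<open>t i ^ 0 = 1\<close>, so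
      it lies outside the interference hyperplane and complements it.\<close>
    define v where "v = received H Q i i 0"
    have v: "dotp (\<psi> i) v = 1"
      using vdm[OF \<open>0 < ?n\<close>, of i] by (simp add: v_def received_def dotp_vector_matrix_mult)
    have "v \<in> ?S"
      unfolding signal_space_def column_space_def v_def using \<open>0 < ?n\<close> by (intro vec.span_base) auto
    then have vS: "c *s v \<in> ?S" for c
      unfolding signal_space_def column_space_def by (rule vec.span_scale)
    have "w \<in> {u + v | u v. u \<in> ?S \<and> v \<in> ?I}" for w
    proof -
      have "w = dotp (\<psi> i) w *s v + (w - dotp (\<psi> i) w *s v)" by simp
      moreover have "w - dotp (\<psi> i) w *s v \<in> ?I"
        unfolding I using v by (simp add: dotp_diff_right dotp_scale_right)
      ultimately show ?thesis using vS by blast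
    qed
    then have full: "{u + v | u v. u \<in> ?S \<and> v \<in> ?I} = UNIV" by blast
    show ?thesis
      unfolding FIA_def full vec_dim_card using \<open>vec.dim ?I \<le> ?n\<close> M by simp
  qed
  have "dotp (\<psi> i) (columns_mult ?n (received H Q i i) (\<lambda>l. x l - y l)) \<noteq> 0"
    if "x \<in> X i" "y \<in> X i" "x \<noteq> y" for i x y
  proof -
    have "dotp (\<psi> i) (columns_mult ?n (received H Q i i) (\<lambda>l. x l - y l)) = (\<Sum>l<?n. (x l - y l) * t i ^ l)"
      unfolding columns_mult_def dotp_sum_right
      by (intro sum.cong) (use vdm in \<open>auto simp: dotp_scale_right received_def dotp_diff_right left_diff_distrib dotp_vector_matrix_mult\<close>)
    then show ?thesis using t(2)[OF that] by simp
  qed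
  from that[OF rank FIA orth this] show thesis .
qed

lemma generic_achievable:
  fixes H :: "'m::finite channel"
  assumes M: "CARD('m) \<ge> 2" and H: "generic H" and sig: "finite_signaling X b lab"
  shows "achievable H X b lab (\<lambda>_. (real CARD('m) - 1) / real CARD('m))"
proof -
  let ?n = "CARD('m) - 1"
  have n: "?n \<ge> 1" using M by simp
  have X: "finite (X i ?n)" "X i ?n \<noteq> {}" "X i ?n \<subseteq> extensional {..<?n}" for i
    using sig n unfolding finite_signaling_def by blast+
  obtain Q \<psi> where Q: "\<And>j. full_column_rank ?n (Q j)" "\<And>i. FIA H (\<lambda>_. ?n) Q i"
    and orth: "\<And>i j l. j \<noteq> i \<Longrightarrow> l < ?n \<Longrightarrow> dotp (\<psi> i) (received H Q i j l) = 0"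
    and sep: "\<And>i x y. x \<in> X i ?n \<Longrightarrow> y \<in> X i ?n \<Longrightarrow> x \<noteq> y \<Longrightarrow>
      dotp (\<psi> i) (columns_mult ?n (received H Q i i) (\<lambda>l. x l - y l)) \<noteq> 0"
    using aligned_precoders[OF M H, of "\<lambda>i. X i ?n", OF X(1,3)] by blast
  have "((\<lambda>s. BER H (\<lambda>_. ?n) Q s i (X i ?n) (b i ?n) (lab i ?n)) \<longlongrightarrow> 0) (at_right 0)" for i
    by (rule BER_tendsto_0[where n = "\<lambda>_. ?n" and \<psi> = "\<psi> i", OF X(1,2) orth sep])
  moreover have "(real CARD('m) - 1) / real CARD('m) = SpAC TYPE('m) ?n"
    using M by (simp add: SpAC_def of_nat_diff)
  ultimately show ?thesis
    unfolding achievable_def using n Q by (intro exI[of _ "\<lambda>_. ?n"] exI[of _ Q]) auto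
qed

lemma achievable_SpAC_le:
  fixes H :: "'m::finite channel"
  assumes "\<And>i j. det (H i j) \<noteq> 0" "achievable H X b lab d"
  shows "d j \<le> (real CARD('m) - 1) / real CARD('m)"
proof -
  obtain n Q where "d j = SpAC TYPE('m) (n j)" "full_column_rank (n j) (Q j)" "\<And>i. FIA H n Q i"
    using assms(2) unfolding achievable_def by blast
  moreover obtain i where "i \<noteq> j" using exhaust_3[of j] by (metis zero_neq_one)
  ultimately have "n j < CARD('m)" using full_rank_interferer_streams_less[of H n Q i j] assms(1) by blast
  then show ?thesis
    using \<open>d j = _\<close> by (simp add: SpAC_def divide_right_mono)
qed

section \<open>Almost sure genericity of the channel\<close>

definition channel_of :: "(3 \<times> 3 \<times> 'm \<times> 'm \<Rightarrow> complex) \<Rightarrow> 'm::finite channel" where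
  "channel_of x = (\<lambda>i j. \<chi> a c. x (i, j, a, c))"

lemma channel_of_entries: "channel_of (\<lambda>(i, j, a, c). h i j $ a $ c) = h"
  by (simp add: channel_of_def fun_eq_iff vec_eq_iff)

lemma polymat_channel_of: "polymat (\<lambda>x. channel_of x i j)"
  by (simp add: polymat_def channel_of_def polyfun.coord)

lemma polymat_obstruction: "polymat (\<lambda>x. obstruction i (channel_of x :: 'm::finite channel))"
  unfolding obstruction_def loop1_def loop2_def direct_def
  by (cases "i = 1"; cases "i = 2")
     (simp_all add: polymat_mult polymat_diff polymat_adjugate polymat_channel_of)

text \<open>Independence makes the joint law of all entries a product measure. Each genericity
  condition is then the nonvanishing of a polynomial for which one nonzero value is known.\<close>

lemma AE_generic:
  fixes P :: "'w measure"
    and H :: "'w \<Rightarrow> 3 \<Rightarrow> 3 \<Rightarrow> complex ^ 'm::finite ^ 'm"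
    and \<mu> :: "complex measure"
  assumes M: "CARD('m) \<ge> 2"
    and P: "prob_space P"
    and indep: "prob_space.indep_vars P (\<lambda>_. borel)
           (\<lambda>(i, j, a, c) \<omega>. H \<omega> i j $ a $ c) (UNIV :: (3 \<times> 3 \<times> 'm \<times> 'm) set)"
    and distr: "\<And>i j a c. distr P borel (\<lambda>\<omega>. H \<omega> i j $ a $ c) = \<mu>"
    and atomless: "\<And>z. emeasure \<mu> {z} = 0"
  shows "AE \<omega> in P. generic (H \<omega>)"
proof -
  interpret prob_space P by (rule P)
  define E :: "3 \<times> 3 \<times> 'm \<times> 'm \<Rightarrow> 'w \<Rightarrow> complex" where
    "E = (\<lambda>(i, j, a, c) \<omega>. H \<omega> i j $ a $ c)"
  let ?U = "UNIV :: (3 \<times> 3 \<times> 'm \<times> 'm) set"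
  have rv: "E k \<in> borel_measurable P" for k
    using indep unfolding E_def indep_vars_def by blast
  have dE: "distr P borel (E k) = \<mu>" for k
    using distr by (cases k) (simp add: E_def)
  have sets: "sets \<mu> = sets borel" and prob: "prob_space \<mu>"
    using dE[of undefined] prob_space_distr[OF rv, of undefined] by (metis sets_distr, simp)
  have "distr P (PiM ?U (\<lambda>_. borel)) (\<lambda>\<omega>. \<lambda>k\<in>?U. E k \<omega>) = PiM ?U (\<lambda>_. \<mu>)"
    using indep_vars_iff_distr_eq_PiM[of ?U E "\<lambda>_. borel"] rv indep dE by (simp add: E_def)
  then have joint: "distr P (PiM ?U (\<lambda>_. \<mu>)) (\<lambda>\<omega> k. E k \<omega>) = PiM ?U (\<lambda>_. \<mu>)"
    using sets by (simp add: restrict_UNIV cong: distr_cong sets_PiM_cong)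
  have meas: "(\<lambda>\<omega> k. E k \<omega>) \<in> measurable P (PiM ?U (\<lambda>_. \<mu>))"
  proof (rule measurable_PiM_single')
    show "E k \<in> measurable P \<mu>" for k
      using rv by (simp add: measurable_cong_sets[OF refl sets])
    show "(\<lambda>\<omega> k. E k \<omega>) \<in> space P \<rightarrow> (\<Pi>\<^sub>E k\<in>?U. space \<mu>)"
      by (simp add: sets_eq_imp_space_eq[OF sets])
  qed
  have nonzero: "AE \<omega> in P. f (\<lambda>k. E k \<omega>) \<noteq> 0" if "polyfun f" "f y \<noteq> 0" for f y
  proof -
    \<comment> \<open>With all coordinates randomised nothing of \<open>y\<close> is left in the
      argument of \<open>f\<close>.\<close>
    have "AE x in PiM ?U (\<lambda>_. \<mu>). f x \<noteq> 0"
      using AE_polyfun_nonzero[OF prob sets atomless that, of ?U] by (simp add: override_on_def)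
    then have "AE x in distr P (PiM ?U (\<lambda>_. \<mu>)) (\<lambda>\<omega> k. E k \<omega>). f x \<noteq> 0"
      unfolding joint .
    then show ?thesis by (rule AE_distrD[OF meas])
  qed
  have entries: "channel_of (\<lambda>k. E k \<omega>) = H \<omega>" for \<omega>
    unfolding E_def by (subst (2) channel_of_entries[symmetric]) (simp add: case_prod_unfold)
  have "AE \<omega> in P. det (H \<omega> i j) \<noteq> 0" for i j
  proof -
    \<comment> \<open>The witness is the channel with all matrices equal to the identity.\<close>
    have "det (channel_of (\<lambda>(i, j, a, c). (mat 1 :: complex ^ 'm ^ 'm) $ a $ c) i j) \<noteq> 0"
      by (simp add: channel_of_entries)
    from nonzero[OF polyfun_det[OF polymat_channel_of] this] show ?thesis by (simp add: entries)
  qed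
  moreover have "AE \<omega> in P. det (obstruction i (H \<omega>)) \<noteq> 0" for i
  proof -
    from generic_witness[OF M] obtain h :: "'m channel" where "\<forall>i. det (obstruction i h) \<noteq> 0" ..
    then have "det (obstruction i (channel_of (\<lambda>(i, j, a, c). h i j $ a $ c))) \<noteq> 0"
      by (simp add: channel_of_entries)
    from nonzero[OF polyfun_det[OF polymat_obstruction] this] show ?thesis by (simp add: entries)
  qed
  ultimately show ?thesis
    unfolding generic_def by (auto simp: AE_all_countable)
qed

theorem theorem2:
  fixes P :: "'w measure"
    and H :: "'w \<Rightarrow> 3 \<Rightarrow> 3 \<Rightarrow> complex ^ 'm::finite ^ 'm"
    and \<mu> :: "complex measure"
  assumes "CARD('m) \<ge> 2"
    and "prob_space P"
    and "prob_space.indep_vars P (\<lambda>_. borel)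
           (\<lambda>(i, j, a, c) \<omega>. H \<omega> i j $ a $ c) (UNIV :: (3 \<times> 3 \<times> 'm \<times> 'm) set)"
    and "\<And>i j a c. distr P borel (\<lambda>\<omega>. H \<omega> i j $ a $ c) = \<mu>"
    and "\<And>z. emeasure \<mu> {z} = 0"
  shows "AE \<omega> in P. \<forall>X b lab. finite_signaling X b lab \<longrightarrow>
           achievable (H \<omega>) X b lab (\<lambda>_. (real CARD('m) - 1) / real CARD('m)) \<and>
           (\<forall>d. achievable (H \<omega>) X b lab d \<longrightarrow>
                  (\<forall>j. d j \<le> (real CARD('m) - 1) / real CARD('m)))"
  using AE_generic[OF assms]
proof eventually_elim
  \<comment> \<open>Genericity mentions only the channel, so one null set serves all alphabets and
    labellings.\<close>
  case (elim \<omega>)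
  then have "det (H \<omega> i j) \<noteq> 0" for i j by (simp add: generic_def)
  with elim show ?case
    using generic_achievable[OF assms(1)] achievable_SpAC_le[of "H \<omega>"] by blast
qed

end
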